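(* Let $G,H$ be finite connected graphs and let $f: V(G)\to V(H)$ be any mapping. Assume that $G$ is planar, that the maximum degree satisfies $\Delta(G)\le 3$, and that $H$ is outerplanar. Then the Sierpiński product $G\otimes_f H$ is planar.
   Context: Graphs are undirected and simple. For graphs $G,H$ and a function $f:V(G)\to V(H)$, the Sierpiński product $G\otimes_f H$ is the graph with vertex set $V(G)\times V(H)$ and the following edges: $\{(g,h),(g,h')\}$ for every $g\in V(G)$ and every $\{h,h'\}\in E(H)$; and $\{(g,f(g')),(g',f(g))\}$ for every $\{g,g'\}\in E(G)$. *)

theory Defs
  imports "HOL-Analysis.Analysis" "Graph_Theory.Digraph_Component" "Graph_Theory.Pair_Digraph"
begin

text \<open>
  A finite simple undirected graph is a \<^locale>\<open>pair_graph\<close>: a finite, loop-free, symmetric set of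
  arcs. An undirected edge \<open>{u, v}\<close> is thus represented by the two arcs \<open>(u, v)\<close> and \<open>(v, u)\<close>.
\<close>

definition edges :: "'a pair_pre_digraph \<Rightarrow> 'a set set" where
  "edges G = {{u, v} | u v. (u, v) \<in> parcs G}"

text \<open>
  By symmetry the out-degree of a vertex is its number of neighbours. The supremum is a maximum
  for a finite graph, and \<open>0\<close> for the graph without vertices.
\<close>

definition max_degree :: "'a pair_pre_digraph \<Rightarrow> nat" where
  "max_degree G = (SUP v\<in>pverts G. out_degree (with_proj G) v)"

definition sierpinski_product ::
  "'a pair_pre_digraph \<Rightarrow> ('a \<Rightarrow> 'b) \<Rightarrow> 'b pair_pre_digraph \<Rightarrow> ('a \<times> 'b) pair_pre_digraph" where
  "sierpinski_product G f H =
    \<lparr> pverts = pverts G \<times> pverts H,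
      parcs = {((g, h), (g, h')) | g h h'. g \<in> pverts G \<and> (h, h') \<in> parcs H}
            \<union> {((g, f g'), (g', f g)) | g g'. (g, g') \<in> parcs G} \<rparr>"

text \<open>
  A drawing of a graph in the plane without crossings: vertices are distinct points, every edge
  is a simple arc joining its two end vertices and passing through no other vertex, and two
  different edges meet at most in common end vertices.
\<close>

definition plane_drawing ::
  "'a pair_pre_digraph \<Rightarrow> ('a \<Rightarrow> complex) \<Rightarrow> ('a set \<Rightarrow> real \<Rightarrow> complex) \<Rightarrow> bool" where
  "plane_drawing G p \<gamma> \<longleftrightarrow>
    inj_on p (pverts G) \<and>
    (\<forall>e\<in>edges G. arc (\<gamma> e) \<and> {pathstart (\<gamma> e), pathfinish (\<gamma> e)} = p ` e \<and>
       path_image (\<gamma> e) \<inter> p ` pverts G = p ` e) \<and>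
    (\<forall>e\<in>edges G. \<forall>e'\<in>edges G. e \<noteq> e' \<longrightarrow>
       path_image (\<gamma> e) \<inter> path_image (\<gamma> e') \<subseteq> p ` (e \<inter> e'))"

definition drawing_image ::
  "'a pair_pre_digraph \<Rightarrow> ('a \<Rightarrow> complex) \<Rightarrow> ('a set \<Rightarrow> real \<Rightarrow> complex) \<Rightarrow> complex set" where
  "drawing_image G p \<gamma> = p ` pverts G \<union> (\<Union>e\<in>edges G. path_image (\<gamma> e))"

definition planar :: "'a pair_pre_digraph \<Rightarrow> bool" where
  "planar G \<longleftrightarrow> (\<exists>p \<gamma>. plane_drawing G p \<gamma>)"

text \<open>
  For a finite graph the image of a drawing is compact, so \<^const>\<open>outside\<close> of it is the unique
  unbounded component of its complement, that is, the outer face. A graph is outerplanar if it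
  has a drawing with all vertices on the boundary of the outer face.
\<close>

definition outerplanar :: "'a pair_pre_digraph \<Rightarrow> bool" where
  "outerplanar G \<longleftrightarrow>
    (\<exists>p \<gamma>. plane_drawing G p \<gamma> \<and> p ` pverts G \<subseteq> frontier (outside (drawing_image G p \<gamma>)))"

end

theory Submission
  imports Defs
begin

text \<open>
  Around every vertex \<open>v\<close> of a drawing choose a small disc, and cut every edge at its last exit from
  the disc of its first end and its first entrance into the disc of its second end. For \<open>G\<close> this leaves
  at most three points on each bounding circle, and it suffices to draw a copy of \<open>H\<close> inside each
  disc together with disjoint arcs from the vertices \<open>f g'\<close> to these points.

  For \<open>H\<close> the interior of the discs is redrawn with radii. Janiszewski's theorem shows that the vertices
  stay accessible: for small discs, a point of the outer face away from the discs is not cut off from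
  infinity when the discs are added to the drawing. Hence three additional radii, one for each
  neighbour of \<open>g\<close>, can be joined by a tripod with centre \<open>t\<close> in the outer face. Inverting at \<open>t\<close>
  puts \<open>H\<close> into a disc with three arcs to the bounding circle. Three points on a circle have only
  two cyclic orders, so after a reflection, if necessary, these arcs can be prolonged by
  spirals to any three prescribed points.
\<close>

text \<open>Edges are arbitrary topological arcs: near a vertex they may wind, leave a disc and
  return any number of times, so a vertex on the frontier of the outer face offers no evident
  approach. What can be controlled is a point on a small circle around the vertex, after which the
  disc is refilled with radii. The danger is that the filled discs, together with pieces of edges
  that come back into them, block the way to infinity; local connectedness of the drawing at its
  vertices excludes this. The degree bound enters through cyclic orders: the arcs leaving a copy of
  \<open>H\<close> reach the circle in an order that is not controlled, and a copy can only be
  reflected as a whole. For three points this suffices, for four it would not. The copies lie in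
  disjoint discs, so each may be reflected independently of the others. Several neighbours of
  \<open>g\<close> may have the same image under \<open>f\<close>. Arcs are therefore indexed by
  neighbours, may start at a common vertex, and need distinct access points on one circle.\<close>

hide_const (open) Digraph_Component.connected

section \<open>Arcs as point sets\<close>

text \<open>Drawings are cut and glued repeatedly, and then only the point set and its two ends
  matter. Dropping the parametrisation turns reversal, restriction and gluing into statements about
  sets.\<close>

definition arc_between :: "'a::topological_space set \<Rightarrow> 'a \<Rightarrow> 'a \<Rightarrow> bool" where
  "arc_between S a b \<longleftrightarrow> (\<exists>g. arc g \<and> path_image g = S \<and> pathstart g = a \<and> pathfinish g = b)"

lemma arc_betweenI: "arc g \<Longrightarrow> arc_between (path_image g) (pathstart g) (pathfinish g)"
  unfolding arc_between_def by blast

lemma arc_between_sym: "arc_between S a b \<Longrightarrow> arc_between S b a"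
  unfolding arc_between_def
  by (metis arc_reversepath path_image_reversepath pathfinish_reversepath pathstart_reversepath)

lemma arc_between_ends: "arc_between S a b \<Longrightarrow> a \<in> S \<and> b \<in> S \<and> a \<noteq> b"
  unfolding arc_between_def using arc_distinct_ends by fastforce

lemma arc_between_compact: "arc_between S a b \<Longrightarrow> compact S"
  and arc_between_connected: "arc_between S a b \<Longrightarrow> connected S"
  unfolding arc_between_def using compact_arc_image connected_arc_image by blast+

lemma arc_between_closed: "arc_between S a b \<Longrightarrow> closed (S :: 'a::t2_space set)"
  using arc_between_compact compact_imp_closed by blast

lemma arc_between_join:
  "arc_between S a b \<Longrightarrow> arc_between T b c \<Longrightarrow> S \<inter> T = {b} \<Longrightarrow> arc_between (S \<union> T) a c"
  unfolding arc_between_def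
  by (metis arc_join order_refl path_image_join pathfinish_join pathstart_join)

lemma arc_between_image:
  assumes "arc_between S a b" "continuous_on S h" "inj_on h S"
  shows "arc_between (h ` S) (h a) (h b)"
proof -
  obtain g where g: "arc g" "path_image g = S" "pathstart g = a" "pathfinish g = b"
    using assms(1) unfolding arc_between_def by blast
  have "arc (h \<circ> g)"
    using assms g unfolding arc_def
    by (auto simp: path_continuous_image path_image_def intro!: comp_inj_on)
  then show ?thesis
    unfolding arc_between_def using g
    by (metis path_image_compose pathfinish_compose pathstart_compose)
qed

lemma arc_between_segment:
  "a \<noteq> b \<Longrightarrow> arc_between (closed_segment a b) a (b :: 'a::real_normed_vector)"
  unfolding arc_between_def
  by (metis arc_linepath path_image_linepath pathfinish_linepath pathstart_linepath)

lemma arc_between_path_connected: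
  "path_connected S \<Longrightarrow> a \<in> S \<Longrightarrow> b \<in> S \<Longrightarrow> a \<noteq> b \<Longrightarrow> \<exists>T\<subseteq>S. arc_between T a (b :: 'a::{complete_space,real_normed_vector})"
  unfolding arc_between_def path_connected_arcwise by metis

text \<open>With \<open>s\<close> the last parameter in \<open>D\<close> and \<open>t\<close> the
  first parameter after \<open>s\<close> in \<open>E\<close>, the piece between them meets both sets
  only at its ends. Choosing \<open>s\<close> first matters, since the first visit to
  \<open>E\<close> may precede the last visit to \<open>D\<close>. A singleton may serve as
  \<open>D\<close> or \<open>E\<close>, which then leaves that end in place.\<close>

lemma arc_between_truncate:
  fixes S :: "'a::real_normed_vector set"
  assumes "arc_between S a b" "closed D" "closed E" "D \<inter> E = {}" "a \<in> D" "b \<in> E"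
  obtains T x y where "arc_between T x y" "T \<subseteq> S" "T \<inter> D = {x}" "T \<inter> E = {y}"
proof -
  obtain g where g: "arc g" "path_image g = S" "pathstart g = a" "pathfinish g = b"
    using assms(1) unfolding arc_between_def by blast
  have cont: "continuous_on {0..1} g"
    using g(1) by (simp add: arc_def path_def)
  define P where "P = {0..1} \<inter> g -` D"
  have "closed P"
    unfolding P_def by (intro continuous_closed_preimage cont assms) auto
  then have "compact P"
    unfolding P_def by (metis bounded_Int bounded_closed_interval compact_eq_bounded_closed)
  moreover have "0 \<in> P"
    using g assms by (auto simp: P_def pathstart_def)
  ultimately obtain s where s: "s \<in> P" "\<And>t. t \<in> P \<Longrightarrow> t \<le> s"
    by (metis compact_attains_sup empty_iff)
  have s01: "0 \<le> s" "s \<le> 1" using s by (auto simp: P_def)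
  define Q where "Q = {s..1} \<inter> g -` E"
  have "closed Q"
    unfolding Q_def using s01
    by (intro continuous_closed_preimage continuous_on_subset[OF cont] assms) auto
  then have "compact Q"
    unfolding Q_def by (metis bounded_Int bounded_closed_interval compact_eq_bounded_closed)
  moreover have "1 \<in> Q"
    using g assms s01 by (auto simp: Q_def pathfinish_def)
  ultimately obtain t where t: "t \<in> Q" "\<And>u. u \<in> Q \<Longrightarrow> t \<le> u"
    by (metis compact_attains_inf empty_iff)
  have "s \<noteq> t" using s t assms(4) by (auto simp: P_def Q_def)
  then have st: "s < t" "t \<le> 1" using t by (auto simp: Q_def)
  have im: "path_image (subpath s t g) = g ` {s..t}"
    using st by (simp add: path_image_subpath)
  have "arc (subpath s t g)"
    using g(1) st s01 by (intro arc_subpath_arc) auto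
  then have "arc_between (g ` {s..t}) (g s) (g t)"
    using arc_betweenI[of "subpath s t g"] im by simp
  moreover have "g ` {s..t} \<subseteq> S"
    using g(2) st s01 by (auto simp: path_image_def)
  moreover have "u = s" if "s \<le> u" "u \<le> t" "g u \<in> D" for u
    using s(2)[of u] that st s01 by (auto simp: P_def)
  then have "g ` {s..t} \<inter> D \<subseteq> {g s}" by fastforce
  then have "g ` {s..t} \<inter> D = {g s}"
    using s(1) st by (auto simp: P_def)
  moreover have "u = t" if "s \<le> u" "u \<le> t" "g u \<in> E" for u
    using t(2)[of u] that st s01 by (auto simp: Q_def)
  then have "g ` {s..t} \<inter> E \<subseteq> {g t}" by fastforce
  then have "g ` {s..t} \<inter> E = {g t}"
    using t(1) st by (auto simp: Q_def)
  ultimately show ?thesis using that by blast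
qed

lemma arc_between_split:
  fixes S :: "'a::real_normed_vector set"
  assumes "arc_between S a b" "x \<in> S" "x \<noteq> a" "x \<noteq> b"
  obtains S1 S2 where "S = S1 \<union> S2" "S1 \<inter> S2 = {x}" "arc_between S1 a x" "arc_between S2 x b"
proof -
  obtain g where g: "arc g" "path_image g = S" "pathstart g = a" "pathfinish g = b"
    using assms(1) unfolding arc_between_def by blast
  then obtain s where s: "0 \<le> s" "s \<le> 1" "g s = x"
    using assms(2) by (auto simp: path_image_def)
  have s': "0 < s" "s < 1"
    using s g assms(3,4) by (auto simp: pathstart_def pathfinish_def less_le)
  have inj: "inj_on g {0..1}" using g(1) by (simp add: arc_def)
  have 1: "arc_between (g ` {0..s}) a x"
    using arc_betweenI[OF arc_subpath_arc[OF g(1), of 0 s]] s s' g(3)[unfolded pathstart_def]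
    by (simp add: path_image_subpath)
  have 2: "arc_between (g ` {s..1}) x b"
    using arc_betweenI[OF arc_subpath_arc[OF g(1), of s 1]] s s' g(4)[unfolded pathfinish_def]
    by (simp add: path_image_subpath)
  have "{0..1} = {0..s} \<union> {s..1}" using s by auto
  then have "S = g ` {0..s} \<union> g ` {s..1}"
    using g(2) by (metis image_Un path_image_def)
  moreover have "g ` {0..s} \<inter> g ` {s..1} = g ` ({0..s} \<inter> {s..1})"
    using inj s by (intro inj_on_image_Int[symmetric]) auto
  moreover have "{0..s} \<inter> {s..1} = {s}" using s by auto
  ultimately show ?thesis using that 1 2 s(3) by auto
qed

lemma arc_between_connected_delete:
  assumes "arc_between S a b"
  shows "connected (S - {a})"
proof -
  obtain g where g: "arc g" "path_image g = S" "pathstart g = a" "pathfinish g = b"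
    using assms(1) unfolding arc_between_def by blast
  have inj: "inj_on g {0..1}" and cont: "continuous_on {0..1} g"
    using g(1) by (simp_all add: arc_def path_def)
  have "{0..1::real} - {0} = {0<..1}" by auto
  then have "S - {a} = g ` {0<..1}"
    using g inj_on_image_set_diff[OF inj, of "{0..1}" "{0}"]
    by (auto simp: path_image_def pathstart_def)
  then show ?thesis
    using cont by (auto intro!: connected_continuous_image elim: continuous_on_subset)
qed

lemma arc_between_in_closure:
  fixes a :: "'a::metric_space"
  assumes "arc_between S a b"
  shows "a \<in> closure (S - {a})"
proof -
  have "a islimpt S"
    using connected_imp_perfect[OF arc_between_connected[OF assms], of a] arc_between_ends[OF assms]
    by fast
  then show ?thesis by (simp add: islimpt_in_closure)
qed

text \<open>An end of an arc is not isolated in it, so an end inside the open disc would bring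
  further points of the arc into the disc.\<close>

lemma arc_between_touch_sphere:
  fixes a :: "'a::metric_space"
  assumes "arc_between S a b" "S \<inter> cball c r = {a}"
  shows "dist c a = r"
proof (rule ccontr)
  assume "dist c a \<noteq> r"
  moreover have "a \<in> cball c r" using assms(2) by blast
  ultimately have "a \<in> ball c r" by simp
  then obtain y where "y \<in> S - {a}" "y \<in> ball c r"
    using arc_between_in_closure[OF assms(1)]
    unfolding closure_iff_nhds_not_empty by (metis disjoint_iff open_ball subset_refl)
  then show False using assms(2) ball_subset_cball[of c r] by blast
qed

lemma path_connected_insert_Un:
  assumes "path_connected (insert a S)" "path_connected (insert b S)" "S \<noteq> {}"
  shows "path_connected (insert a (insert b S))"
proof -
  have "path_connected (insert a S \<union> insert b S)"
    using assms by (intro path_connected_Un) auto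
  then show ?thesis by (simp add: insert_commute)
qed

lemma arc_between_not_two_points:
  fixes a :: "'a::metric_space"
  assumes "arc_between S a b"
  shows "\<not> S \<subseteq> {a, b}"
proof
  assume "S \<subseteq> {a, b}"
  then have "finite S" using finite_subset by auto
  then show False
    using arc_between_connected[OF assms] arc_between_ends[OF assms]
    by (auto simp: connected_finite_iff_sing)
qed

text \<open>An arc \<open>S\<close> joins \<open>z1\<close> to \<open>z2\<close>, and an arc from
  \<open>z3\<close> is stopped at its first contact \<open>y\<close> with \<open>S\<close>. Since
  \<open>y\<close> lies in \<open>\<Omega>\<close>, it is none of the feet; it splits
  \<open>S\<close> into two legs and becomes the centre.\<close>

lemma tripod3:
  fixes \<Omega> :: "'a::{complete_space,real_normed_vector} set"
  assumes "path_connected (insert z1 \<Omega>)" "path_connected (insert z2 \<Omega>)" "path_connected (insert z3 \<Omega>)"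
    and "z1 \<notin> \<Omega>" "z2 \<notin> \<Omega>" "z3 \<notin> \<Omega>" "z1 \<noteq> z2" "z1 \<noteq> z3" "z2 \<noteq> z3" "\<Omega> \<noteq> {}"
  obtains t A1 A2 A3 where "t \<in> \<Omega>"
    "arc_between A1 z1 t" "arc_between A2 z2 t" "arc_between A3 z3 t"
    "A1 \<subseteq> insert z1 \<Omega>" "A2 \<subseteq> insert z2 \<Omega>" "A3 \<subseteq> insert z3 \<Omega>"
    "A1 \<inter> A2 = {t}" "A1 \<inter> A3 = {t}" "A2 \<inter> A3 = {t}"
proof -
  obtain S where S: "S \<subseteq> insert z1 (insert z2 \<Omega>)" "arc_between S z1 z2"
    using arc_between_path_connected[OF path_connected_insert_Un[OF assms(1,2,10)], of z1 z2] assms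
    by auto
  \<comment> \<open>An arc has a point besides its ends; here it gives the third arc a target on
    \<open>S\<close> that lies in \<open>insert z3 \<Omega>\<close>.\<close>
  obtain m where m: "m \<in> S" "m \<in> \<Omega>"
    using arc_between_not_two_points[OF S(2)] S(1) by blast
  obtain R where R: "R \<subseteq> insert z3 \<Omega>" "arc_between R z3 m"
    using arc_between_path_connected[OF assms(3), of z3 m] assms m by auto
  have "z3 \<notin> S" using S assms by auto
  then obtain T x y where T: "arc_between T x y" "T \<subseteq> R" "T \<inter> {z3} = {x}" "T \<inter> S = {y}"
    using arc_between_truncate[OF R(2), of "{z3}" S] arc_between_closed[OF S(2)] m by auto
  have [simp]: "x = z3" using T by auto
  have y: "y \<in> \<Omega>" "y \<in> S" using T R S \<open>z3 \<notin> S\<close> by auto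
  then have "y \<noteq> z1" "y \<noteq> z2" using assms by auto
  then obtain S1 S2 where S12: "S = S1 \<union> S2" "S1 \<inter> S2 = {y}" "arc_between S1 z1 y" "arc_between S2 y z2"
    using arc_between_split[OF S(2) y(2)] by metis
  show ?thesis
  proof (rule that[OF y(1) S12(3) arc_between_sym[OF S12(4)]])
    have e: "z1 \<in> S1" "y \<in> S1" "y \<in> S2" "z2 \<in> S2" "z1 \<noteq> y" "z2 \<noteq> y"
      using arc_between_ends[OF S12(3)] arc_between_ends[OF S12(4)] by auto
    have "z2 \<notin> S1" "z1 \<notin> S2" using S12(2) e by blast+
    then show "S1 \<subseteq> insert z1 \<Omega>" "S2 \<subseteq> insert z2 \<Omega>" using S12(1) S(1) by blast+
    show "arc_between T z3 y" using T(1) by simp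
    show "T \<subseteq> insert z3 \<Omega>" using T(2) R(1) by blast
    show "S1 \<inter> S2 = {y}" by fact
    show "S1 \<inter> T = {y}" "S2 \<inter> T = {y}"
      using S12(1) T(4) e by blast+
  qed
qed

lemma tripod:
  fixes \<Omega> :: "'a::{complete_space,real_normed_vector} set"
  assumes "card I = 3" "\<Omega> \<noteq> {}" "inj_on z I"
    and "\<And>i. i \<in> I \<Longrightarrow> path_connected (insert (z i) \<Omega>)" "\<And>i. i \<in> I \<Longrightarrow> z i \<notin> \<Omega>"
  obtains t A where "t \<in> \<Omega>" "\<And>i. i \<in> I \<Longrightarrow> arc_between (A i) (z i) t"
    "\<And>i. i \<in> I \<Longrightarrow> A i \<subseteq> insert (z i) \<Omega>"
    "\<And>i j. i \<in> I \<Longrightarrow> j \<in> I \<Longrightarrow> i \<noteq> j \<Longrightarrow> A i \<inter> A j = {t}"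
proof -
  obtain i j k where I: "I = {i, j, k}" "i \<noteq> j" "i \<noteq> k" "j \<noteq> k"
    using assms(1) by (auto simp: card_3_iff)
  have z: "z i \<noteq> z j" "z i \<noteq> z k" "z j \<noteq> z k" using I assms(3) by (auto simp: inj_on_def)
  have i: "i \<in> I" "j \<in> I" "k \<in> I" using I by auto
  obtain t A1 A2 A3 where A: "t \<in> \<Omega>"
    "arc_between A1 (z i) t" "arc_between A2 (z j) t" "arc_between A3 (z k) t"
    "A1 \<subseteq> insert (z i) \<Omega>" "A2 \<subseteq> insert (z j) \<Omega>" "A3 \<subseteq> insert (z k) \<Omega>"
    "A1 \<inter> A2 = {t}" "A1 \<inter> A3 = {t}" "A2 \<inter> A3 = {t}"
    by (rule tripod3[OF i[THEN assms(4)] i[THEN assms(5)] z assms(2)])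
  define B where "B = (\<lambda>l. if l = i then A1 else if l = j then A2 else A3)"
  have [simp]: "B i = A1" "B j = A2" "B k = A3" using I by (auto simp: B_def)
  show ?thesis
  proof (rule that[of t B])
    show "t \<in> \<Omega>" by fact
    fix l assume l: "l \<in> I"
    show "arc_between (B l) (z l) t" using A(2-4) l I(1) by auto
    show "B l \<subseteq> insert (z l) \<Omega>" using A(5-7) l I(1) by auto
    fix m assume m: "m \<in> I" "l \<noteq> m"
    have "B i \<inter> B j = {t}" "B i \<inter> B k = {t}" "B j \<inter> B k = {t}"
      using A(8-10) by simp_all
    with l m show "B l \<inter> B m = {t}"
      unfolding I(1) by (metis Int_commute insertE empty_iff)
  qed
qed

section \<open>Accessibility of the outer face\<close>

lemma closed_segment_subset_cball:
  fixes c :: "'a::real_normed_vector"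
  shows "dist c x = r \<Longrightarrow> closed_segment c x \<subseteq> cball c r"
  by (intro closed_segment_subset) (auto simp: zero_le_dist[of c x, simplified])

text \<open>The distance from \<open>c\<close> fixes the parameter on either radius, so a common
  point has the same parameter on both, and it must be \<open>0\<close> because the outer ends
  differ. This is what prevents crossings inside a disc redrawn with radii.\<close>

lemma radii_Int:
  fixes c :: "'a::real_normed_vector"
  assumes "dist c x = r" "dist c y = r" "x \<noteq> y"
  shows "closed_segment c x \<inter> closed_segment c y = {c}"
proof -
  have "z = c" if z: "z \<in> closed_segment c x" "z \<in> closed_segment c y" for z
  proof -
    obtain u where u: "0 \<le> u" "z = (1 - u) *\<^sub>R c + u *\<^sub>R x"
      using z(1) by (auto simp: in_segment)
    obtain v where v: "0 \<le> v" "z = (1 - v) *\<^sub>R c + v *\<^sub>R y"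
      using z(2) by (auto simp: in_segment)
    have zu: "z - c = u *\<^sub>R (x - c)" using u(2) by (simp add: algebra_simps)
    have zv: "z - c = v *\<^sub>R (y - c)" using v(2) by (simp add: algebra_simps)
    have "norm (z - c) = u * r"
      using u(1) assms(1) by (simp add: zu dist_norm norm_minus_commute)
    moreover have "norm (z - c) = v * r"
      using v(1) assms(2) by (simp add: zv dist_norm norm_minus_commute)
    moreover have "r \<noteq> 0" using assms by auto
    ultimately have "u = v" by auto
    then have "u *\<^sub>R (x - c) = u *\<^sub>R (y - c)" using zu zv by metis
    then have "u = 0" using assms(3) by auto
    then show ?thesis using zu by simp
  qed
  then show ?thesis by auto
qed

text \<open>Near \<open>z\<close> there is no point of \<open>K\<close>. Every nearby point off the
  disc can be pushed along the outward normal \<open>u\<close> into the part \<open>H\<close> of a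
  small ball beyond the tangent line, and \<open>H\<close> is convex. So all these points share one
  component of the complement, and one of them is in the outer face because \<open>z\<close> is in
  its closure.\<close>

lemma outside_near_sphere:
  fixes z p :: complex
  assumes r: "dist p z = r" "0 < r" and K: "closed K" "z \<notin> K"
    and z: "z \<in> closure (outside (K \<union> cball p r))"
  obtains e where "0 < e" "ball z e - cball p r \<subseteq> outside (K \<union> cball p r)"
proof -
  obtain d where d: "0 < d" "ball z d \<inter> K = {}"
    using K by (metis Compl_iff disjoint_eq_subset_Compl open_Compl open_contains_ball)
  \<comment> \<open>A push of length \<open>2 * e\<close> from \<open>ball z e\<close> stays in
    \<open>ball z (4 * e)\<close>, away from \<open>K\<close>; and \<open>e \<le> r\<close> gives
    \<open>(w - p) \<bullet> u \<ge> 0\<close>, so the push never decreases the distance from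
    \<open>p\<close>.\<close>
  define e where "e = min (d / 4) r"
  have e: "0 < e" "4 * e \<le> d" "e \<le> r" using d r by (auto simp: e_def)
  define u where "u = (z - p) /\<^sub>R r"
  have nu: "norm u = 1" using r by (simp add: u_def dist_norm norm_minus_commute)
  have zu: "(z - p) \<bullet> u = r"
    using r by (simp add: u_def dot_square_norm dist_norm norm_minus_commute power2_eq_square)
  define H where "H = ball z (4 * e) \<inter> {v. u \<bullet> v > u \<bullet> p + r}"
  have "convex H"
    unfolding H_def by (intro convex_Int convex_ball convex_halfspace_gt)
  have Hp: "H \<inter> cball p r = {}"
  proof -
    have "v \<notin> cball p r" if "u \<bullet> v > u \<bullet> p + r" for v
    proof -
      have "u \<bullet> (v - p) \<le> norm u * norm (v - p)" by (rule norm_cauchy_schwarz)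
      then show ?thesis using that nu by (simp add: inner_diff_right dist_norm norm_minus_commute)
    qed
    then show ?thesis unfolding H_def by blast
  qed
  have push: "\<exists>h\<in>H. connected_component (- (K \<union> cball p r)) w h" if w: "w \<in> ball z e - cball p r" for w
  proof -
    have wz: "norm (w - z) < e" using w by (simp add: dist_norm norm_minus_commute)
    have "- ((w - z) \<bullet> u) \<le> norm (w - z)"
      using norm_cauchy_schwarz[of "z - w" u] nu by (simp add: inner_diff_left norm_minus_commute)
    then have wu: "(w - p) \<bullet> u \<ge> r - e"
      using zu wz by (simp add: inner_diff_left)
    \<comment> \<open>A point of \<open>ball z e\<close> lies at most \<open>e\<close> below the
      tangent line at \<open>z\<close>, so \<open>2 * e\<close> carries it strictly across.\<close>
    define h where "h = w + (2 * e) *\<^sub>R u"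
    have seg: "v \<in> - cball p r \<inter> ball z (4 * e)" if v: "v \<in> closed_segment w h" for v
    proof -
      obtain s where s: "0 \<le> s" "s \<le> 1" "v = (1 - s) *\<^sub>R w + s *\<^sub>R h"
        using v by (auto simp: in_segment)
      define q where "q = s * (2 * e)"
      have q: "0 \<le> q" "q \<le> 2 * e" using s e by (auto simp: q_def mult_left_le_one_le)
      have vq: "v = w + q *\<^sub>R u" by (simp add: s(3) h_def q_def algebra_simps)
      have vp: "v - p = (w - p) + q *\<^sub>R u" by (simp add: vq)
      have "(norm (v - p))\<^sup>2 = (norm (w - p))\<^sup>2 + 2 * q * ((w - p) \<bullet> u) + q\<^sup>2 * (u \<bullet> u)"
        unfolding power2_norm_eq_inner vp inner_add_left inner_add_right
        by (simp add: inner_commute power2_eq_square)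
      also have "\<dots> \<ge> (norm (w - p))\<^sup>2"
        using q wu e(3) by simp
      finally have "norm (v - p) \<ge> norm (w - p)"
        by (rule power2_le_imp_le) simp
      moreover have "norm (w - p) > r" using w by (simp add: dist_norm norm_minus_commute)
      moreover have "norm (v - z) \<le> norm (w - z) + norm (q *\<^sub>R u)"
        using norm_triangle_ineq[of "w - z" "q *\<^sub>R u"] by (simp add: vq algebra_simps)
      then have "norm (v - z) < 4 * e" using wz q nu e by simp
      ultimately show ?thesis by (auto simp: dist_norm norm_minus_commute)
    qed
    have "closed_segment w h \<subseteq> - (K \<union> cball p r)"
    proof -
      have "ball z (4 * e) \<subseteq> ball z d" using e by (intro subset_ball) auto
      then show ?thesis using seg d by blast
    qed
    then have "connected_component (- (K \<union> cball p r)) w h"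
      unfolding connected_component_def
      by (intro exI[of _ "closed_segment w h"]) auto
    moreover have "h \<in> H"
    proof -
      have "h \<in> ball z (4 * e)" using seg[of h] by auto
      moreover have "u \<bullet> h > u \<bullet> p + r"
      proof -
        have "u \<bullet> h = u \<bullet> w + 2 * e"
          using nu by (simp add: h_def inner_add_right dot_square_norm)
        moreover have "u \<bullet> w - u \<bullet> p \<ge> r - e"
          using wu by (simp add: inner_diff_right inner_commute)
        ultimately show ?thesis using e by linarith
      qed
      ultimately show ?thesis by (simp add: H_def)
    qed
    ultimately show ?thesis by blast
  qed
  have Hsub: "H \<subseteq> - (K \<union> cball p r)"
  proof -
    have "ball z (4 * e) \<subseteq> ball z d" using e by (intro subset_ball) auto
    then show ?thesis using Hp d unfolding H_def by blast
  qed
  obtain w0 where w0: "w0 \<in> outside (K \<union> cball p r)" "dist w0 z < e"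
    using z e by (metis closure_approachable)
  have "w0 \<in> ball z e - cball p r"
  proof -
    have "w0 \<notin> cball p r" using w0(1) outside_no_overlap by blast
    then show ?thesis using w0(2) by (simp add: dist_commute)
  qed
  then obtain h0 where h0: "h0 \<in> H" "connected_component (- (K \<union> cball p r)) w0 h0"
    using push by blast
  have "w \<in> outside (K \<union> cball p r)" if w: "w \<in> ball z e - cball p r" for w
  proof -
    obtain h where h: "h \<in> H" "connected_component (- (K \<union> cball p r)) w h"
      using push w by blast
    have "connected_component (- (K \<union> cball p r)) h0 h"
      unfolding connected_component_def
      using \<open>convex H\<close> Hsub h0(1) h(1) convex_connected by blast
    then have "connected_component (- (K \<union> cball p r)) w0 w"
      using h0(2) h(2) by (meson connected_component_sym connected_component_trans)
    then show ?thesis using w0(1) outside_same_component by blast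
  qed
  then show ?thesis using that e(1) by blast
qed

text \<open>The set \<open>C\<close> makes Janiszewski's theorem applicable: \<open>S\<close> meets \<open>cball c r \<union> C\<close> in the connected set \<open>C\<close>.\<close>
lemma outside_add_cball:
  fixes S :: "complex set"
  assumes "compact S" "closed C" "connected C" "S \<inter> cball c r \<subseteq> C" "C \<subseteq> S" "C \<subseteq> ball c R" "r < R"
    and "q \<in> outside S" "q \<notin> ball c R"
  shows "q \<in> outside (S \<union> cball c r)"
proof -
  have "bounded (S \<union> ball c R)"
    using assms(1) by (simp add: compact_imp_bounded)
  \<comment> \<open>\<open>b\<close> represents infinity: it is in the outer face of each of the
    sets involved, so membership in its component decides the claim.\<close>
  then obtain b where b: "b \<in> outside (S \<union> ball c R)" using outside_bounded_nonempty by blast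
  have cb: "cball c r \<subseteq> ball c R" using assms(7) by auto
  then have b2: "b \<in> outside (S \<union> cball c r)" "b \<in> outside S"
    using b outside_mono[of "S \<union> cball c r" "S \<union> ball c R"] outside_mono[of S "S \<union> ball c R"] by blast+
  have "b \<notin> ball c R" using b outside_no_overlap by blast
  have "connected (outside S)"
    using assms(1) by (simp add: compact_imp_bounded connected_outside)
  then have 1: "connected_component (- S) b q"
    unfolding connected_component_def using b2(2) assms(8) outside_no_overlap[of S] by blast
  \<comment> \<open>For the second set in Janiszewski's theorem: \<open>b\<close> and
    \<open>q\<close> are joined outside the large ball, which contains the disc and
    \<open>C\<close>.\<close>
  have "connected (- ball c R)"
    by (intro connected_complement_bounded_convex) auto
  then have 2: "connected_component (- (cball c r \<union> C)) b q"
    unfolding connected_component_def using \<open>b \<notin> ball c R\<close> assms(6,9) cb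
    by (intro exI[of _ "- ball c R"]) blast
  have "S \<inter> (cball c r \<union> C) = C" using assms(4,5) by blast
  then have "connected_component (- (S \<union> (cball c r \<union> C))) b q"
    using assms(1,2,3) 1 2 Janiszewski[of S "cball c r \<union> C" b q] by (metis closed_Un closed_cball)
  moreover have "S \<union> (cball c r \<union> C) = S \<union> cball c r" using assms(5) by blast
  ultimately show ?thesis using b2(1) outside_same_component by metis
qed

text \<open>Follow an arc of the outer face from a point \<open>q\<close> near \<open>p\<close> to a
  point \<open>b\<close> beyond the disc and cut it at its last exit \<open>z\<close> from the disc.
  The rest runs to \<open>b\<close> off \<open>K\<close> and off the disc, so \<open>z\<close> is
  approached from the new outer face. The arc need not come from \<open>p\<close>, as the disc will
  be refilled with radii.\<close>

lemma frontier_outside_reach: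
  fixes K :: "complex set"
  assumes "compact K" "p \<in> frontier (outside K)" "0 < r"
  obtains z where "dist p z = r" "z \<notin> K" "z \<in> closure (outside (K \<union> cball p r))"
proof -
  have opn: "open (outside K)"
    using assms(1) by (simp add: compact_imp_closed open_outside)
  have "p \<in> closure (outside K)" using assms(2) by (simp add: frontier_def)
  then obtain q where q: "q \<in> outside K" "dist q p < r"
    using assms(3) closure_approachable by metis
  have "bounded (K \<union> cball p r)"
    using assms(1) by (simp add: compact_imp_bounded)
  then obtain b where b: "b \<in> outside (K \<union> cball p r)" using outside_bounded_nonempty by blast
  then have bK: "b \<in> outside K" "b \<notin> cball p r"
    using outside_mono[of K "K \<union> cball p r"] outside_no_overlap by blast+
  have "path_connected (outside K)"
    using assms(1) opn by (simp add: compact_imp_bounded connected_outside connected_open_path_connected)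
  moreover have "q \<noteq> b" using q bK by (auto simp: dist_commute)
  ultimately obtain S where S: "S \<subseteq> outside K" "arc_between S q b"
    using arc_between_path_connected[of "outside K" q b] q bK by blast
  obtain T z y where T: "arc_between T z y" "T \<subseteq> S" "T \<inter> cball p r = {z}" "T \<inter> {b} = {y}"
    by (rule arc_between_truncate[OF S(2), of "cball p r" "{b}"]) (use q bK in \<open>auto simp: dist_commute\<close>)
  have [simp]: "y = b" using T(4) by blast
  have TK: "T \<inter> K = {}" using T(2) S(1) outside_no_overlap by blast
  have zT: "z \<in> T" "b \<in> T" "z \<noteq> b" using arc_between_ends[OF T(1)] by auto
  have sub: "T - {z} \<subseteq> outside (K \<union> cball p r)"
  proof
    fix w assume w: "w \<in> T - {z}"
    have "T - {z} \<subseteq> - (K \<union> cball p r)" using TK T(3) by blast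
    then have "connected_component (- (K \<union> cball p r)) b w"
      unfolding connected_component_def using arc_between_connected_delete[OF T(1)] w zT by blast
    then show "w \<in> outside (K \<union> cball p r)" using b outside_same_component by blast
  qed
  show ?thesis
  proof (rule that)
    show "dist p z = r" by (rule arc_between_touch_sphere[OF T(1,3)])
    show "z \<notin> K" using TK zT by blast
    show "z \<in> closure (outside (K \<union> cball p r))"
      using arc_between_in_closure[OF T(1)] closure_mono[OF sub] by blast
  qed
qed

text \<open>A connected set with two points has no isolated point; the second point is the antipode
  \<open>2 * p - z\<close>. Infinitely many points leave room for several access points at one
  vertex.\<close>

lemma infinite_sphere_Int_ball:
  fixes z p :: complex
  assumes "dist p z = r" "0 < r" "0 < e"
  shows "infinite (sphere p r \<inter> ball z e)"
proof -
  have "connected (sphere p r)" by (intro connected_sphere) auto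
  moreover have "z \<in> sphere p r" using assms by simp
  moreover have "\<not> sphere p r = {z}"
  proof
    assume "sphere p r = {z}"
    moreover have "2 * p - z \<in> sphere p r"
      using assms by (simp add: dist_norm norm_minus_commute)
    ultimately have "z = p" by auto
    then show False using assms by simp
  qed
  ultimately have "z islimpt sphere p r" by (metis connected_imp_perfect singletonD)
  then show ?thesis using assms(3) islimpt_eq_infinite_ball by blast
qed

text \<open>A path in the outer face that starts near the vertex \<open>c a\<close> may run through the discs of other
  vertices. It only yields access from \<open>outside (K \<union> cball (c a) r)\<close>; the other discs are then added
  one at a time.\<close>
lemma infinite_access_points:
  fixes c :: "'v \<Rightarrow> complex"
  assumes V: "finite V" "a \<in> V" and K: "compact K" and r: "0 < r" "r < R"
    and disj: "\<And>v w. v \<in> V \<Longrightarrow> w \<in> V \<Longrightarrow> v \<noteq> w \<Longrightarrow> ball (c v) R \<inter> ball (c w) R = {}"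
    and loc: "\<And>w. w \<in> V \<Longrightarrow> \<exists>C. closed C \<and> connected C \<and> K \<inter> cball (c w) r \<subseteq> C \<and> C \<subseteq> K \<inter> ball (c w) R"
    and front: "c a \<in> frontier (outside K)"
  defines "\<Omega> \<equiv> outside (K \<union> (\<Union>w\<in>V. cball (c w) r))"
  shows "infinite {z. dist (c a) z = r \<and> z \<notin> K \<and> (\<exists>e>0. ball z e - cball (c a) r \<subseteq> \<Omega>)}"
proof -
  have cb: "cball (c w) r \<subseteq> ball (c w) R" for w using r by auto
  obtain z where z: "dist (c a) z = r" "z \<notin> K" "z \<in> closure (outside (K \<union> cball (c a) r))"
    using frontier_outside_reach[OF K front r(1)] by blast
  obtain e where e: "0 < e" "ball z e - cball (c a) r \<subseteq> outside (K \<union> cball (c a) r)"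
    using outside_near_sphere[OF z(1) r(1) compact_imp_closed[OF K] z(2,3)] by blast
  obtain d where d: "0 < d" "ball z d \<inter> K = {}"
    using compact_imp_closed[OF K] z(2)
    by (metis Compl_iff disjoint_eq_subset_Compl open_Compl open_contains_ball)
  \<comment> \<open>\<open>e' \<le> d\<close> keeps the access points off \<open>K\<close>;
    \<open>e' \<le> R - r\<close> keeps them in the large disc of \<open>a\<close>, hence off the
    large discs of all other vertices, as \<open>outside_add_cball\<close> demands.\<close>
  define e' where "e' = min (min e d) (R - r)"
  have e': "0 < e'" "e' \<le> e" "e' \<le> d" "e' \<le> R - r" using e d r by (auto simp: e'_def)
  have inR: "ball z e' \<subseteq> ball (c a) R"
  proof
    fix w assume "w \<in> ball z e'"
    then have "dist (c a) w < r + e'" using z(1) dist_triangle[of "c a" w z] by simp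
    then show "w \<in> ball (c a) R" using e' by simp
  qed
  have add: "q \<in> outside (K \<union> cball (c a) r \<union> (\<Union>w\<in>W. cball (c w) r))"
    if "finite W" "W \<subseteq> V - {a}" "q \<in> ball z e' - cball (c a) r" for q W
    using that(1,2)
  proof (induction W rule: finite_induct)
    case empty
    then show ?case using that(3) e(2) e'(2) by auto
  next
    case (insert w W)
    let ?S = "K \<union> cball (c a) r \<union> (\<Union>w\<in>W. cball (c w) r)"
    have w: "w \<in> V" "w \<noteq> a" using insert by auto
    obtain C where C: "closed C" "connected C" "K \<inter> cball (c w) r \<subseteq> C" "C \<subseteq> K \<inter> ball (c w) R"
      using loc w by blast
    \<comment> \<open>The discs already added miss the disc of \<open>w\<close>, so the set
      \<open>C\<close> obtained for \<open>K\<close> alone still serves for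
      \<open>?S\<close>.\<close>
    have "cball (c v) r \<inter> cball (c w) r = {}" if "v \<in> insert a W" for v
      using disj[of v w] cb[of v] cb[of w] that w V(2) insert by blast
    then have "?S \<inter> cball (c w) r \<subseteq> C" using C(3) by blast
    moreover have "compact ?S"
      using K insert.hyps(1) by (intro compact_Un compact_UN) auto
    moreover have "q \<notin> ball (c w) R" using that(3) inR disj[of a w] w V(2) by blast
    moreover have "q \<in> outside ?S" using insert by blast
    ultimately have "q \<in> outside (?S \<union> cball (c w) r)"
      using outside_add_cball[of ?S C "c w" r R q] C r by blast
    then show ?case by (simp add: Un_ac)
  qed
  have "K \<union> cball (c a) r \<union> (\<Union>w\<in>V - {a}. cball (c w) r) = K \<union> (\<Union>w\<in>V. cball (c w) r)"
    using V(2) by blast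
  then have sub: "ball z e' - cball (c a) r \<subseteq> \<Omega>"
    using add[of "V - {a}"] V(1) unfolding \<Omega>_def by auto
  have "sphere (c a) r \<inter> ball z e' \<subseteq>
      {z. dist (c a) z = r \<and> z \<notin> K \<and> (\<exists>e>0. ball z e - cball (c a) r \<subseteq> \<Omega>)}"
  proof clarify
    fix y assume y: "y \<in> sphere (c a) r" "y \<in> ball z e'"
    then obtain d' where "d' > 0" "ball y d' \<subseteq> ball z e'"
      using openE[OF open_ball] by metis
    moreover have "y \<in> ball z d" using y(2) e'(3) by simp
    then have "y \<notin> K" using d(2) by blast
    ultimately show "dist (c a) y = r \<and> y \<notin> K \<and> (\<exists>e>0. ball y e - cball (c a) r \<subseteq> \<Omega>)"
      using y sub by (auto intro!: exI[of _ d'])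
  qed
  then show ?thesis
    using infinite_sphere_Int_ball[OF z(1) r(1) e'(1)] finite_subset by blast
qed

text \<open>A segment of length \<open>e / 2\<close> along the outward normal leaves the disc at
  once and ends in \<open>\<Omega>\<close>, which is path connected as an open connected
  set.\<close>

lemma path_connected_insert_sphere_point:
  fixes z p :: complex
  assumes "open \<Omega>" "connected \<Omega>" "dist p z = r" "0 < r" "0 < e" "ball z e - cball p r \<subseteq> \<Omega>"
  shows "path_connected (insert z \<Omega>)"
proof -
  define u where "u = (z - p) /\<^sub>R r"
  have nu: "norm u = 1" using assms by (simp add: u_def dist_norm norm_minus_commute)
  define h where "h = z + (e / 2) *\<^sub>R u"
  have "v \<in> insert z \<Omega>" if v: "v \<in> closed_segment z h" for v
  proof (cases "v = z")
    case False
    obtain s where s: "0 \<le> s" "s \<le> 1" "v = (1 - s) *\<^sub>R z + s *\<^sub>R h"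
      using v by (auto simp: in_segment)
    then have vz: "v = z + (s * (e / 2)) *\<^sub>R u" by (simp add: h_def algebra_simps)
    have "s > 0" using s False by (cases "s = 0") auto
    have "r *\<^sub>R u = z - p" using assms(4) by (simp add: u_def)
    then have "v - p = (r + s * (e / 2)) *\<^sub>R u"
      by (simp add: vz scaleR_add_left)
    then have "norm (v - p) = \<bar>r + s * (e / 2)\<bar>" using nu by simp
    moreover have "r + s * (e / 2) > r" using \<open>s > 0\<close> assms by simp
    ultimately have "norm (v - p) > r" using assms(4) by simp
    moreover have "norm (v - z) = s * (e / 2)" using s(1) assms(5) nu by (simp add: vz)
    moreover have "s * (e / 2) \<le> e / 2" using s assms(5) by (simp add: mult_left_le_one_le)
    then have "s * (e / 2) < e" using assms(5) by simp
    ultimately have "v \<in> ball z e - cball p r" by (simp add: dist_norm norm_minus_commute)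
    then show ?thesis using assms(6) by blast
  qed simp
  then have sub: "closed_segment z h \<subseteq> insert z \<Omega>" by blast
  have "h \<noteq> z" using nu assms(5) by (auto simp: h_def)
  then have "h \<in> \<Omega>" using sub by auto
  have "path_connected (\<Omega> \<union> closed_segment z h)"
    using assms(1,2) \<open>h \<in> \<Omega>\<close>
    by (intro path_connected_Un) (auto simp: connected_open_path_connected)
  moreover have "\<Omega> \<union> closed_segment z h = insert z \<Omega>" using sub by auto
  ultimately show ?thesis by simp
qed

section \<open>Cutting a drawing at small discs around the vertices\<close>

text \<open>The form of \<open>plane_drawing\<close> with edges as point sets. Inclusions suffice,
  since \<open>arc_between\<close> already puts the ends of an edge on it.\<close>

definition plane_arcs :: "'a pair_pre_digraph \<Rightarrow> ('a \<Rightarrow> complex) \<Rightarrow> ('a set \<Rightarrow> complex set) \<Rightarrow> bool" where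
  "plane_arcs G p A \<longleftrightarrow>
    inj_on p (pverts G) \<and>
    (\<forall>u v. (u, v) \<in> parcs G \<longrightarrow> arc_between (A {u, v}) (p u) (p v)) \<and>
    (\<forall>e\<in>edges G. A e \<inter> p ` pverts G \<subseteq> p ` e) \<and>
    (\<forall>e\<in>edges G. \<forall>e'\<in>edges G. e \<noteq> e' \<longrightarrow> A e \<inter> A e' \<subseteq> p ` (e \<inter> e'))"

definition arcs_image :: "'a pair_pre_digraph \<Rightarrow> ('a \<Rightarrow> complex) \<Rightarrow> ('a set \<Rightarrow> complex set) \<Rightarrow> complex set" where
  "arcs_image G p A = p ` pverts G \<union> (\<Union>e\<in>edges G. A e)"

lemma plane_arcsD:
  assumes "plane_arcs G p A"
  shows "inj_on p (pverts G)"
    and "(u, v) \<in> parcs G \<Longrightarrow> arc_between (A {u, v}) (p u) (p v)"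
    and "e \<in> edges G \<Longrightarrow> A e \<inter> p ` pverts G \<subseteq> p ` e"
    and "e \<in> edges G \<Longrightarrow> e' \<in> edges G \<Longrightarrow> e \<noteq> e' \<Longrightarrow> A e \<inter> A e' \<subseteq> p ` (e \<inter> e')"
  using assms unfolding plane_arcs_def by simp_all

lemma edgesE:
  assumes "e \<in> edges G"
  obtains u v where "e = {u, v}" "(u, v) \<in> parcs G"
  using assms unfolding edges_def by blast

lemma edgesI: "(u, v) \<in> parcs G \<Longrightarrow> {u, v} \<in> edges G"
  unfolding edges_def by blast

lemma plane_drawing_imp_plane_arcs:
  assumes "plane_drawing G p \<gamma>"
  shows "plane_arcs G p (\<lambda>e. path_image (\<gamma> e))"
proof -
  have "arc_between (path_image (\<gamma> {u, v})) (p u) (p v)" if uv: "(u, v) \<in> parcs G" for u v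
  proof -
    let ?g = "\<gamma> {u, v}"
    have g: "arc ?g" "{pathstart ?g, pathfinish ?g} = {p u, p v}"
      using assms edgesI[OF uv] unfolding plane_drawing_def by auto
    from g(2) have "pathstart ?g = p u \<and> pathfinish ?g = p v \<or> pathstart ?g = p v \<and> pathfinish ?g = p u"
      by (simp add: doubleton_eq_iff)
    then show ?thesis
      using arc_betweenI[OF g(1)] arc_between_sym by metis
  qed
  then show ?thesis using assms unfolding plane_drawing_def plane_arcs_def by auto
qed

lemma plane_arcs_imp_planar:
  assumes "plane_arcs G p A" and wf: "parcs G \<subseteq> pverts G \<times> pverts G"
  shows "planar G"
proof -
  have "\<exists>g. arc g \<and> {pathstart g, pathfinish g} = p ` e \<and> path_image g = A e" if e: "e \<in> edges G" for e
  proof -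
    obtain u v where uv: "e = {u, v}" "(u, v) \<in> parcs G" using e by (rule edgesE)
    have "arc_between (A {u, v}) (p u) (p v)"
      using plane_arcsD(2)[OF assms(1)] uv(2) .
    then have "arc_between (A e) (p u) (p v)" using uv(1) by simp
    then obtain g where "arc g" "path_image g = A e" "pathstart g = p u" "pathfinish g = p v"
      unfolding arc_between_def by blast
    then show ?thesis using uv(1) by (intro exI[of _ g]) simp
  qed
  then obtain \<gamma> where \<gamma>: "\<And>e. e \<in> edges G \<Longrightarrow> arc (\<gamma> e) \<and>
      {pathstart (\<gamma> e), pathfinish (\<gamma> e)} = p ` e \<and> path_image (\<gamma> e) = A e"
    by metis
  have "A e \<inter> p ` pverts G = p ` e" if e: "e \<in> edges G" for e
  proof -
    obtain u v where uv: "e = {u, v}" "(u, v) \<in> parcs G" using e by (rule edgesE)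
    have "{pathstart (\<gamma> e), pathfinish (\<gamma> e)} \<subseteq> path_image (\<gamma> e)"
      by (simp add: pathstart_in_path_image pathfinish_in_path_image)
    then have "p ` e \<subseteq> A e" using \<gamma>[OF e] by metis
    moreover have "e \<subseteq> pverts G" using uv wf by auto
    moreover have "A e \<inter> p ` pverts G \<subseteq> p ` e" using plane_arcsD(3)[OF assms(1)] e .
    ultimately show ?thesis by blast
  qed
  then have "plane_drawing G p \<gamma>"
    using plane_arcsD[OF assms(1)] \<gamma> unfolding plane_drawing_def by simp
  then show ?thesis unfolding planar_def by blast
qed

text \<open>The arc \<open>B e\<close> is what remains of the edge \<open>e\<close> outside the discs of radius \<open>r\<close> around its two
  ends, and \<open>x e w\<close> is the point where it meets the disc of its end \<open>w\<close>.\<close>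
definition disc_arcs ::
  "'a pair_pre_digraph \<Rightarrow> ('a \<Rightarrow> complex) \<Rightarrow> real \<Rightarrow> ('a set \<Rightarrow> 'a \<Rightarrow> complex) \<Rightarrow> ('a set \<Rightarrow> complex set) \<Rightarrow> bool"
where
  "disc_arcs G c r x B \<longleftrightarrow> 0 < r \<and>
    (\<forall>u\<in>pverts G. \<forall>v\<in>pverts G. u \<noteq> v \<longrightarrow> cball (c u) r \<inter> cball (c v) r = {}) \<and>
    (\<forall>u v. (u, v) \<in> parcs G \<longrightarrow> arc_between (B {u, v}) (x {u, v} u) (x {u, v} v)) \<and>
    (\<forall>e\<in>edges G. \<forall>w\<in>pverts G. B e \<inter> cball (c w) r = (if w \<in> e then {x e w} else {})) \<and>
    (\<forall>e\<in>edges G. \<forall>w\<in>e. dist (c w) (x e w) = r) \<and>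
    (\<forall>e\<in>edges G. \<forall>e'\<in>edges G. e \<noteq> e' \<longrightarrow> B e \<inter> B e' = {})"

lemma disc_arcsD:
  assumes "disc_arcs G c r x B"
  shows "0 < r"
    and "u \<in> pverts G \<Longrightarrow> v \<in> pverts G \<Longrightarrow> u \<noteq> v \<Longrightarrow> cball (c u) r \<inter> cball (c v) r = {}"
    and "(u, v) \<in> parcs G \<Longrightarrow> arc_between (B {u, v}) (x {u, v} u) (x {u, v} v)"
    and "e \<in> edges G \<Longrightarrow> w \<in> pverts G \<Longrightarrow> w \<in> e \<Longrightarrow> B e \<inter> cball (c w) r = {x e w}"
    and "e \<in> edges G \<Longrightarrow> w \<in> pverts G \<Longrightarrow> w \<notin> e \<Longrightarrow> B e \<inter> cball (c w) r = {}"
    and "e \<in> edges G \<Longrightarrow> w \<in> e \<Longrightarrow> dist (c w) (x e w) = r"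
    and "e \<in> edges G \<Longrightarrow> e' \<in> edges G \<Longrightarrow> e \<noteq> e' \<Longrightarrow> B e \<inter> B e' = {}"
  using assms unfolding disc_arcs_def by simp_all

text \<open>Smallness conditions on a radius are collected as properties that hold eventually in
  \<open>at_right 0\<close>, so that finitely many of them can be conjoined without naming their
  bounds.\<close>

lemma eventually_at_right_0_less: "0 < d \<Longrightarrow> \<forall>\<^sub>F r in at_right 0. 0 < r \<and> r < (d::real)"
  using eventually_at_right_real[of 0 d] by simp

lemma eventually_cball_disjoint:
  fixes S :: "'a::metric_space set"
  assumes "closed S" "a \<notin> S"
  shows "\<forall>\<^sub>F r in at_right 0. S \<inter> cball a r = {}"
proof -
  obtain d where d: "0 < d" "ball a d \<subseteq> - S"
    using assms by (meson ComplI open_Compl open_contains_ball)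
  show ?thesis
    using eventually_at_right_0_less[OF d(1)]
  proof eventually_elim
    case (elim r)
    then have "cball a r \<subseteq> ball a d" by auto
    then show ?case using d(2) by blast
  qed
qed

lemma eventually_cball_cball_disjoint:
  fixes a :: "'a::metric_space"
  assumes "a \<noteq> b"
  shows "\<forall>\<^sub>F r in at_right 0. cball a r \<inter> cball b r = {}"
proof -
  have "0 < dist a b / 2" using assms by simp
  from eventually_at_right_0_less[OF this] show ?thesis
  proof eventually_elim
    case (elim r)
    show ?case
    proof (rule ccontr)
      assume "cball a r \<inter> cball b r \<noteq> {}"
      then obtain z where "dist a z \<le> r" "dist b z \<le> r" by auto
      then have "dist a b \<le> r + r" using dist_triangle2[of a b z] by linarith
      then show False using elim by simp
    qed
  qed
qed

lemma (in pair_graph) finite_edges: "finite (edges G)"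
proof -
  have "edges G \<subseteq> (\<lambda>(u, v). {u, v}) ` parcs G" unfolding edges_def by auto
  then show ?thesis using pair_finite_arcs finite_subset by blast
qed

lemma (in pair_graph) compact_arcs_image:
  assumes "plane_arcs G p A"
  shows "compact (arcs_image G p A)"
proof -
  have "compact (A e)" if "e \<in> edges G" for e
    using that by (rule edgesE) (auto dest: plane_arcsD(2)[OF assms] intro: arc_between_compact)
  then show ?thesis
    unfolding arcs_image_def using pair_finite_verts finite_edges
    by (intro compact_Un compact_UN finite_imp_compact[of "p ` pverts G"]) auto
qed

lemma (in pair_graph) edge_subset: "e \<in> edges G \<Longrightarrow> e \<subseteq> pverts G"
  unfolding edges_def by (auto dest: in_arcsD1 in_arcsD2)

text \<open>Small discs are disjoint and miss every edge that does not end at their centre, so each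
  edge can be truncated at the discs of its two ends. Different edges meet at most in common
  vertices, and truncation has removed these: the only point of \<open>B e\<close> in the disc of an
  end has distance \<open>r\<close> from the centre.\<close>

lemma (in pair_graph) eventually_disc_arcs:
  assumes p: "plane_arcs G p A"
  shows "\<forall>\<^sub>F r in at_right 0. \<exists>x B. disc_arcs G p r x B \<and> (\<forall>e\<in>edges G. B e \<subseteq> A e)"
proof -
  note inj = plane_arcsD(1)[OF p] and arcs = plane_arcsD(2)[OF p]
    and vert = plane_arcsD(3)[OF p] and disj = plane_arcsD(4)[OF p]
  have clA: "closed (A e)" if "e \<in> edges G" for e
    using that by (rule edgesE) (auto dest: arcs intro: arc_between_closed)
  have "\<forall>\<^sub>F r in at_right 0. \<forall>u\<in>pverts G. \<forall>v\<in>pverts G. u \<noteq> v \<longrightarrow> cball (p u) r \<inter> cball (p v) r = {}"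
    using inj by (intro eventually_ball_finite pair_finite_verts ballI)
      (auto simp: inj_on_eq_iff intro!: eventually_cball_cball_disjoint)
  moreover have "\<forall>\<^sub>F r in at_right 0. \<forall>e\<in>edges G. \<forall>w\<in>pverts G. w \<notin> e \<longrightarrow> A e \<inter> cball (p w) r = {}"
  proof (intro eventually_ball_finite pair_finite_verts finite_edges ballI)
    fix e w assume e: "e \<in> edges G" and w: "w \<in> pverts G"
    show "\<forall>\<^sub>F r in at_right 0. w \<notin> e \<longrightarrow> A e \<inter> cball (p w) r = {}"
    proof (cases "w \<in> e")
      case False
      have "p w \<notin> p ` e" using False w inj edge_subset[OF e] by (auto simp: inj_on_def)
      then have "p w \<notin> A e" using vert[OF e] w by blast
      then show ?thesis
        using eventually_cball_disjoint[OF clA[OF e]] by (auto elim: eventually_mono)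
    qed auto
  qed
  ultimately show ?thesis
    using eventually_at_right_0_less[OF zero_less_one]
  proof eventually_elim
    case (elim r)
    then have r: "0 < r" by simp
    \<comment> \<open>Quantifying over every way of writing \<open>e\<close> as
      \<open>{u, v}\<close> makes the cut points depend on the vertex and not on the orientation
      delivered by \<open>edgesE\<close>.\<close>
    have "\<exists>T X. T \<subseteq> A e \<and> (\<forall>u v. e = {u, v} \<longrightarrow> arc_between T (X u) (X v) \<and> T \<inter> cball (p u) r = {X u})"
      if e: "e \<in> edges G" for e
    proof -
      obtain u v where uv: "e = {u, v}" "(u, v) \<in> parcs G" using e by (rule edgesE)
      then have ne: "u \<noteq> v" "u \<in> pverts G" "v \<in> pverts G"
        using pair_no_loops[OF uv(2)] in_arcsD1 in_arcsD2 by auto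
      obtain T a b where T: "arc_between T a b" "T \<subseteq> A e" "T \<inter> cball (p u) r = {a}" "T \<inter> cball (p v) r = {b}"
        by (rule arc_between_truncate[OF arcs[OF uv(2)], of "cball (p u) r" "cball (p v) r"])
          (use elim ne r uv(1) in auto)
      define X where "X = (\<lambda>w. if w = u then a else b)"
      have [simp]: "X u = a" "X v = b" using ne by (simp_all add: X_def)
      have "arc_between T (X u') (X v') \<and> T \<inter> cball (p u') r = {X u'}" if "e = {u', v'}" for u' v'
      proof -
        have "u' = u \<and> v' = v \<or> u' = v \<and> v' = u" using that uv(1) by (auto simp: doubleton_eq_iff)
        then show ?thesis using T(1,3,4) arc_between_sym[OF T(1)] by fastforce
      qed
      then show ?thesis using T(2) by blast
    qed
    then obtain B x where B: "\<And>e. e \<in> edges G \<Longrightarrow> B e \<subseteq> A e"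
      and Bx: "\<And>e u v. e \<in> edges G \<Longrightarrow> e = {u, v} \<Longrightarrow>
        arc_between (B e) (x e u) (x e v) \<and> B e \<inter> cball (p u) r = {x e u}"
      by metis
    have Bw: "B e \<inter> cball (p w) r = {x e w}" "dist (p w) (x e w) = r"
      if e: "e \<in> edges G" and w: "w \<in> e" for e w
    proof -
      obtain u v where "e = {u, v}" "(u, v) \<in> parcs G" using e by (rule edgesE)
      then obtain w' where w': "e = {w, w'}" using w by auto
      show 1: "B e \<inter> cball (p w) r = {x e w}" using Bx[OF e w'] by blast
      show "dist (p w) (x e w) = r" using arc_between_touch_sphere[OF _ 1] Bx[OF e w'] by blast
    qed
    have "disc_arcs G p r x B"
      unfolding disc_arcs_def
    proof (intro conjI allI ballI impI)
      show "0 < r" by fact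
      show "cball (p u) r \<inter> cball (p v) r = {}" if "u \<in> pverts G" "v \<in> pverts G" "u \<noteq> v" for u v
        using elim(1) that by blast
      show "arc_between (B {u, v}) (x {u, v} u) (x {u, v} v)" if "(u, v) \<in> parcs G" for u v
        using Bx[OF edgesI[OF that]] by blast
      show "B e \<inter> cball (p w) r = (if w \<in> e then {x e w} else {})" if "e \<in> edges G" "w \<in> pverts G" for e w
        using Bw(1)[OF that(1)] elim(2) B[OF that(1)] that by (cases "w \<in> e") (simp, force)
      show "dist (p w) (x e w) = r" if "e \<in> edges G" "w \<in> e" for e w
        using Bw(2) that by blast
      show "B e \<inter> B e' = {}" if e: "e \<in> edges G" "e' \<in> edges G" "e \<noteq> e'" for e e'
      proof -
        have "p w \<notin> B e" if w: "w \<in> e" for w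
        proof
          assume "p w \<in> B e"
          then have "p w \<in> B e \<inter> cball (p w) r" using r by simp
          then have "p w = x e w" using Bw(1)[OF e(1) w] by blast
          then show False using Bw(2)[OF e(1) w] r by simp
        qed
        moreover have "B e \<inter> B e' \<subseteq> p ` (e \<inter> e')" using B[OF e(1)] B[OF e(2)] disj[OF e] by blast
        ultimately show ?thesis by blast
      qed
    qed
    then show ?case using B by blast
  qed
qed

text \<open>The arc may leave \<open>cball a r\<close> and return, so its part in the small disc can
  be disconnected. An initial piece \<open>C\<close> within \<open>ball a R\<close> connects these
  parts, because the compact rest of the arc misses \<open>a\<close> and hence a small disc.\<close>

lemma arc_between_locally_connected_end:
  fixes a :: "'a::metric_space"
  assumes "arc_between S a b" "0 < R"
  shows "\<forall>\<^sub>F r in at_right 0. \<exists>C. closed C \<and> connected C \<and> a \<in> C \<and> S \<inter> cball a r \<subseteq> C \<and> C \<subseteq> S \<inter> ball a R"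
proof -
  obtain g where g: "arc g" "path_image g = S" "pathstart g = a" "pathfinish g = b"
    using assms(1) unfolding arc_between_def by blast
  have cont: "continuous_on {0..1} g" and inj: "inj_on g {0..1}"
    using g(1) by (simp_all add: arc_def path_def)
  have g0: "g 0 = a" using g(3) by (simp add: pathstart_def)
  obtain d where d: "0 < d" "\<And>t. t \<in> {0..1} \<Longrightarrow> dist t 0 < d \<Longrightarrow> dist (g t) (g 0) < R"
    using cont assms(2) unfolding continuous_on_iff by (metis atLeastAtMost_iff order_refl zero_le_one)
  define s where "s = min 1 (d / 2)"
  have s: "0 < s" "s \<le> 1" "s < d" using d(1) by (auto simp: s_def)
  define C where "C = g ` {0..s}"
  have sub: "continuous_on {0..s} g" "continuous_on {s..1} g"
    using s by (auto intro: continuous_on_subset[OF cont])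
  have "compact C" "connected C"
    unfolding C_def using sub(1) by (auto intro: compact_continuous_image connected_continuous_image)
  moreover have "a \<in> C" using s g0 by (force simp: C_def)
  moreover have "C \<subseteq> S \<inter> ball a R"
    using d(2) s g(2) g0 by (auto simp: C_def path_image_def dist_commute)
  moreover have "closed (g ` {s..1})"
    using sub(2) by (intro compact_imp_closed compact_continuous_image) auto
  moreover have "a \<notin> g ` {s..1}"
  proof
    assume "a \<in> g ` {s..1}"
    then obtain t where t: "s \<le> t" "t \<le> 1" "g t = g 0" using g0 by auto
    then have "t = 0" using inj_onD[OF inj t(3)] s by auto
    then show False using t s by simp
  qed
  moreover have "S = C \<union> g ` {s..1}"
  proof -
    have "{0..1} = {0..s} \<union> {s..1}" using s by auto
    then show ?thesis using g(2) by (metis C_def image_Un path_image_def)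
  qed
  ultimately show ?thesis
    using eventually_cball_disjoint[of "g ` {s..1}" a]
    by (auto elim!: eventually_mono intro!: exI[of _ C] compact_imp_closed)
qed

text \<open>Every edge at \<open>w\<close> contributes an initial piece, any other edge only
  \<open>{p w}\<close>; the union is connected because all contributions contain \<open>p w\<close>.
  It supplies the assumption \<open>loc\<close> of \<open>infinite_access_points\<close>.\<close>

lemma (in pair_graph) eventually_locally_connected:
  assumes p: "plane_arcs G p A" and w: "w \<in> pverts G" and R: "0 < R"
  defines "K \<equiv> arcs_image G p A"
  shows "\<forall>\<^sub>F r in at_right 0. \<exists>C. closed C \<and> connected C \<and> K \<inter> cball (p w) r \<subseteq> C \<and> C \<subseteq> K \<inter> ball (p w) R"
proof -
  note inj = plane_arcsD(1)[OF p] and arcs = plane_arcsD(2)[OF p] and vert = plane_arcsD(3)[OF p]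
  have "\<forall>\<^sub>F r in at_right 0. \<forall>e\<in>edges G. \<exists>C. closed C \<and> connected C \<and> p w \<in> C \<and>
      A e \<inter> cball (p w) r \<subseteq> C \<and> C \<subseteq> insert (p w) (A e) \<inter> ball (p w) R"
  proof (intro eventually_ball_finite finite_edges ballI)
    fix e assume e: "e \<in> edges G"
    obtain u v where uv: "e = {u, v}" "(u, v) \<in> parcs G" using e by (rule edgesE)
    show "\<forall>\<^sub>F r in at_right 0. \<exists>C. closed C \<and> connected C \<and> p w \<in> C \<and>
      A e \<inter> cball (p w) r \<subseteq> C \<and> C \<subseteq> insert (p w) (A e) \<inter> ball (p w) R"
    proof (cases "w \<in> e")
      case True
      then obtain b where "arc_between (A e) (p w) b"
        using uv arcs[OF uv(2)] arc_between_sym by auto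
      from arc_between_locally_connected_end[OF this R] show ?thesis
        by (rule eventually_mono) blast
    next
      case False
      then have "p w \<notin> p ` e" using w inj edge_subset[OF e] by (auto simp: inj_on_def)
      then have "p w \<notin> A e" using vert[OF e] w by blast
      moreover have "closed (A e)" using uv(1) arcs[OF uv(2)] arc_between_closed by simp
      ultimately have "\<forall>\<^sub>F r in at_right 0. A e \<inter> cball (p w) r = {}"
        using eventually_cball_disjoint by blast
      then show ?thesis
        by (rule eventually_mono) (use R in \<open>auto intro!: exI[of _ "{p w}"]\<close>)
    qed
  qed
  moreover have "\<forall>\<^sub>F r in at_right 0. (p ` (pverts G - {w})) \<inter> cball (p w) r = {}"
    using pair_finite_verts inj w
    by (intro eventually_cball_disjoint finite_imp_closed) (auto simp: inj_on_def)
  ultimately show ?thesis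
  proof eventually_elim
    case (elim r)
    from elim(1) obtain C where C: "\<And>e. e \<in> edges G \<Longrightarrow> closed (C e) \<and> connected (C e) \<and> p w \<in> C e \<and>
      A e \<inter> cball (p w) r \<subseteq> C e \<and> C e \<subseteq> insert (p w) (A e) \<inter> ball (p w) R"
      by metis
    let ?C = "\<Union> (insert {p w} (C ` edges G))"
    have "closed ?C" using finite_edges C by (intro closed_Union) auto
    moreover have "connected ?C"
      using C by (intro connected_Union) auto
    moreover have "K \<inter> cball (p w) r \<subseteq> ?C"
    proof
      fix y assume y: "y \<in> K \<inter> cball (p w) r"
      then consider "y = p w" | "y \<in> p ` (pverts G - {w})" | e where "e \<in> edges G" "y \<in> A e"
        unfolding K_def arcs_image_def by blast
      then show "y \<in> ?C"
      proof cases
        case 2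
        then show ?thesis using y elim(2) by blast
      next
        case (3 e)
        then have "y \<in> C e" using C[of e] y by blast
        then show ?thesis using 3(1) by blast
      qed simp
    qed
    moreover have "?C \<subseteq> K \<inter> ball (p w) R"
    proof -
      have "p w \<in> K \<inter> ball (p w) R" using w R unfolding K_def arcs_image_def by simp
      moreover have "C e \<subseteq> K \<inter> ball (p w) R" if e: "e \<in> edges G" for e
      proof -
        have "C e \<subseteq> insert (p w) (A e) \<inter> ball (p w) R" using C[OF e] by blast
        moreover have "insert (p w) (A e) \<subseteq> K" using w e unfolding K_def arcs_image_def by blast
        ultimately show ?thesis by blast
      qed
      ultimately show ?thesis by blast
    qed
    ultimately show ?case by blast
  qed
qed

lemma arc_between_attach:
  assumes "arc_between S a x" "arc_between B x y" "arc_between T b y"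
    and "S \<subseteq> D" "T \<subseteq> E" "D \<inter> E = {}" "B \<inter> D = {x}" "B \<inter> E = {y}"
  shows "arc_between (B \<union> (S \<union> T)) a b"
proof -
  have "x \<in> S" "y \<in> T" using assms(1,3) arc_between_ends by blast+
  then have 1: "S \<inter> B = {x}" and 2: "(S \<union> B) \<inter> T = {y}" using assms(4-8) by blast+
  have "arc_between (S \<union> B \<union> T) a b"
    by (rule arc_between_join[OF arc_between_join[OF assms(1,2) 1] arc_between_sym[OF assms(3)] 2])
  then show ?thesis by (simp add: Un_ac)
qed

text \<open>A greedy choice succeeds even if the infinite sets coincide, as happens when several
  arcs start at the same vertex.\<close>

lemma distinct_representatives:
  assumes "finite I" "\<And>i. i \<in> I \<Longrightarrow> infinite (S i)"
  obtains z where "inj_on z I" "\<And>i. i \<in> I \<Longrightarrow> z i \<in> S i"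
proof -
  have "\<exists>z. inj_on z I \<and> (\<forall>i\<in>I. z i \<in> S i)"
    using assms
  proof (induction I rule: finite_induct)
    case (insert j I)
    then obtain z where z: "inj_on z I" "\<forall>i\<in>I. z i \<in> S i" by auto
    have "infinite (S j - z ` I)" using insert by (intro Diff_infinite_finite) auto
    then obtain y where y: "y \<in> S j" "y \<notin> z ` I" by (metis Diff_iff finite.emptyI ex_in_conv)
    let ?z = "z(j := y)"
    have "inj_on ?z (insert j I)"
      using z(1) y(2) insert.hyps(2) by (auto simp: inj_on_def)
    moreover have "\<forall>i\<in>insert j I. ?z i \<in> S i"
      using z(2) y(1) by auto
    ultimately show ?case by blast
  qed auto
  then show ?thesis using that by blast
qed

section \<open>Joining three vertices through the outer face\<close>

text \<open>The drawing returned is a new one, made of radii inside small discs, because radii to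
  further points of the circles can be added to it without crossings.
  \<open>{p (a i)} \<inter> {p (a j)}\<close> is nonempty exactly when two arcs start at the same
  vertex.\<close>

lemma (in pair_graph) outerplanar_tripod:
  assumes "outerplanar G" "card I = 3" "\<And>i. i \<in> I \<Longrightarrow> a i \<in> pverts G"
  obtains p A t E where "plane_arcs G p A" "t \<notin> arcs_image G p A"
    "\<And>i. i \<in> I \<Longrightarrow> arc_between (E i) (p (a i)) t"
    "\<And>i. i \<in> I \<Longrightarrow> E i \<inter> arcs_image G p A \<subseteq> {p (a i)}"
    "\<And>i j. i \<in> I \<Longrightarrow> j \<in> I \<Longrightarrow> i \<noteq> j \<Longrightarrow> E i \<inter> E j \<subseteq> insert t ({p (a i)} \<inter> {p (a j)})"
proof -
  obtain p \<gamma> where p\<gamma>: "plane_drawing G p \<gamma>"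
    and front: "p ` pverts G \<subseteq> frontier (outside (drawing_image G p \<gamma>))"
    using assms(1) unfolding outerplanar_def by blast
  define A where "A = (\<lambda>e. path_image (\<gamma> e))"
  have pA: "plane_arcs G p A" unfolding A_def by (rule plane_drawing_imp_plane_arcs[OF p\<gamma>])
  define K where "K = arcs_image G p A"
  have K_eq: "drawing_image G p \<gamma> = K" unfolding drawing_image_def K_def arcs_image_def A_def ..
  note inj = plane_arcsD(1)[OF pA]
  have K: "compact K" unfolding K_def by (rule compact_arcs_image[OF pA])
  have "\<forall>\<^sub>F R in at_right 0. \<forall>u\<in>pverts G. \<forall>v\<in>pverts G. u \<noteq> v \<longrightarrow> cball (p u) R \<inter> cball (p v) R = {}"
    using inj by (intro eventually_ball_finite pair_finite_verts ballI)
      (auto simp: inj_on_eq_iff intro!: eventually_cball_cball_disjoint)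
  from eventually_happens'[OF _ eventually_conj[OF eventually_at_right_0_less[OF zero_less_one] this]]
  obtain R where R: "0 < R" "\<And>u v. u \<in> pverts G \<Longrightarrow> v \<in> pverts G \<Longrightarrow> u \<noteq> v \<Longrightarrow> cball (p u) R \<inter> cball (p v) R = {}"
    by (auto simp: trivial_limit_at_right_real)
  have "\<forall>\<^sub>F r in at_right 0. \<forall>w\<in>pverts G. \<exists>C. closed C \<and> connected C \<and>
      K \<inter> cball (p w) r \<subseteq> C \<and> C \<subseteq> K \<inter> ball (p w) R"
    unfolding K_def
    by (intro eventually_ball_finite pair_finite_verts ballI eventually_locally_connected[OF pA _ R(1)])
  \<comment> \<open>\<open>r\<close> is chosen after \<open>R\<close>: the part of the drawing in a
    small disc is connected only through a piece that needs the larger disc.\<close>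
  from eventually_happens'[OF _ eventually_conj[OF eventually_conj[OF
        eventually_at_right_0_less[OF R(1)] this] eventually_disc_arcs[OF pA]]]
  obtain r x B where r: "0 < r" "r < R"
    and loc: "\<And>w. w \<in> pverts G \<Longrightarrow> \<exists>C. closed C \<and> connected C \<and> K \<inter> cball (p w) r \<subseteq> C \<and> C \<subseteq> K \<inter> ball (p w) R"
    and B: "disc_arcs G p r x B" "\<And>e. e \<in> edges G \<Longrightarrow> B e \<subseteq> A e"
    by (auto simp: trivial_limit_at_right_real)
  note B_D = disc_arcsD[OF B(1)]
  have BK: "B e \<subseteq> K" if "e \<in> edges G" for e using B(2)[OF that] that unfolding K_def arcs_image_def by blast

  \<comment> \<open>The outer face of the drawing with filled discs, and a tripod in it\<close>
  define M where "M = K \<union> (\<Union>w\<in>pverts G. cball (p w) r)"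
  define \<Omega> where "\<Omega> = outside M"
  have "compact M" unfolding M_def using K pair_finite_verts by (intro compact_Un compact_UN) auto
  then have \<Omega>: "open \<Omega>" "connected \<Omega>"
    unfolding \<Omega>_def by (auto intro!: open_outside connected_outside compact_imp_closed compact_imp_bounded)
  have \<Omega>M: "\<Omega> \<inter> M = {}" unfolding \<Omega>_def using outside_no_overlap by blast
  obtain b where "b \<in> \<Omega>"
    unfolding \<Omega>_def using outside_bounded_nonempty[OF compact_imp_bounded[OF \<open>compact M\<close>]] by blast
  have "finite I" using assms(2) card.infinite by fastforce
  have bdisj: "ball (p u) R \<inter> ball (p v) R = {}" if "u \<in> pverts G" "v \<in> pverts G" "u \<noteq> v" for u v
    using R(2)[OF that] ball_subset_cball by blast
  \<comment> \<open>Access points are taken off \<open>K\<close>, while the cut points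
    \<open>x e w\<close> lie on \<open>K\<close>; so a radius to an access point never coincides
    with a radius of an edge.\<close>
  define S where "S = (\<lambda>i. {z. dist (p (a i)) z = r \<and> z \<notin> K \<and> (\<exists>e>0. ball z e - cball (p (a i)) r \<subseteq> \<Omega>)})"
  have "infinite (S i)" if i: "i \<in> I" for i
    unfolding S_def \<Omega>_def M_def
    by (rule infinite_access_points[OF pair_finite_verts assms(3)[OF i] K r bdisj loc])
      (use front K_eq assms(3)[OF i] in auto)
  then obtain z where "inj_on z I" and "\<And>i. i \<in> I \<Longrightarrow> z i \<in> S i"
    using distinct_representatives[of I S] \<open>finite I\<close> by blast
  then have z: "inj_on z I" "\<And>i. i \<in> I \<Longrightarrow>
      dist (p (a i)) (z i) = r \<and> z i \<notin> K \<and> (\<exists>e>0. ball (z i) e - cball (p (a i)) r \<subseteq> \<Omega>)"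
    unfolding S_def by simp_all
  have zM: "z i \<notin> \<Omega>" if "i \<in> I" for i
  proof -
    have "z i \<in> cball (p (a i)) r" using z(2)[OF that] by simp
    then have "z i \<in> M" unfolding M_def using assms(3)[OF that] by blast
    then show ?thesis using \<Omega>M by blast
  qed
  have pc: "path_connected (insert (z i) \<Omega>)" if "i \<in> I" for i
    using path_connected_insert_sphere_point[OF \<Omega> _ r(1)] z(2)[OF that] by blast
  obtain t T where t: "t \<in> \<Omega>" and T: "\<And>i. i \<in> I \<Longrightarrow> arc_between (T i) (z i) t"
    and T\<Omega>: "\<And>i. i \<in> I \<Longrightarrow> T i \<subseteq> insert (z i) \<Omega>"
    and TT: "\<And>i j. i \<in> I \<Longrightarrow> j \<in> I \<Longrightarrow> i \<noteq> j \<Longrightarrow> T i \<inter> T j = {t}"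
    using tripod[OF assms(2) _ z(1) pc zM] \<open>b \<in> \<Omega>\<close> by (metis empty_iff)

  \<comment> \<open>The drawing with radii, inside and outside the discs\<close>
  define A' where "A' = (\<lambda>e. B e \<union> (\<Union>u\<in>e. closed_segment (p u) (x e u)))"
  define E where "E = (\<lambda>i. closed_segment (p (a i)) (z i) \<union> T i)"
  have seg: "closed_segment (p u) (x e u) \<subseteq> cball (p u) r" if "e \<in> edges G" "u \<in> e" for e u
    using closed_segment_subset_cball B_D(6)[OF that] by blast
  have segz: "closed_segment (p (a i)) (z i) \<subseteq> cball (p (a i)) r" if "i \<in> I" for i
    using closed_segment_subset_cball z(2)[OF that] by blast
  \<comment> \<open>By \<open>A1\<close> and \<open>E1\<close> only radii of the centre occur inside
    a disc; by \<open>A2\<close> and \<open>E2\<close> only the pieces \<open>B e\<close> and the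
    tripod remain outside. Every possible crossing thus reduces to \<open>radii_Int\<close> or to a
    disjointness already known.\<close>
  have A1: "w \<in> e \<and> y \<in> closed_segment (p w) (x e w)"
    if e: "e \<in> edges G" and y: "y \<in> A' e" "y \<in> cball (p w) r" and w: "w \<in> pverts G" for e w y
  proof (cases "y \<in> B e")
    case True
    then have "w \<in> e" using B_D(5)[OF e w] y(2) by blast
    moreover have "y = x e w" using B_D(4)[OF e w \<open>w \<in> e\<close>] y(2) True by blast
    ultimately show ?thesis by simp
  next
    case False
    then obtain u where u: "u \<in> e" "y \<in> closed_segment (p u) (x e u)" using y(1) unfolding A'_def by blast
    then have "y \<in> cball (p u) r" using seg[OF e] by blast
    moreover have "u \<in> pverts G" using edge_subset[OF e] u(1) by blast
    ultimately have "u = w" using B_D(2)[of u w] w y(2) by blast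
    then show ?thesis using u by simp
  qed
  have A2: "y \<in> B e \<or> (\<exists>w\<in>pverts G. y \<in> cball (p w) r)" if e: "e \<in> edges G" and y: "y \<in> A' e" for e y
    using y seg[OF e] edge_subset[OF e] unfolding A'_def by blast
  have E1: "w = a i \<and> y \<in> closed_segment (p w) (z i)"
    if i: "i \<in> I" and y: "y \<in> E i" "y \<in> cball (p w) r" and w: "w \<in> pverts G" for i w y
  proof -
    have "y \<notin> \<Omega>" using \<Omega>M y(2) w unfolding M_def by blast
    then have "y \<in> closed_segment (p (a i)) (z i)" using y(1) T\<Omega>[OF i] unfolding E_def by auto
    moreover from this have "w = a i" using segz[OF i] y(2) B_D(2)[OF w assms(3)[OF i]] by blast
    ultimately show ?thesis by simp
  qed
  have E2: "y \<in> \<Omega> \<and> y \<in> T i" if i: "i \<in> I" and y: "y \<in> E i" "\<not> (\<exists>w\<in>pverts G. y \<in> cball (p w) r)" for i y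
  proof -
    have "y \<notin> cball (p (a i)) r" using y(2) assms(3)[OF i] by blast
    then have "y \<notin> closed_segment (p (a i)) (z i)" using segz[OF i] by blast
    moreover from this have "y \<noteq> z i" by auto
    ultimately show ?thesis using y(1) T\<Omega>[OF i] unfolding E_def by blast
  qed
  have pA': "plane_arcs G p A'"
    unfolding plane_arcs_def
  proof (intro conjI allI ballI impI)
    show "inj_on p (pverts G)" by fact
    show "arc_between (A' {u, v}) (p u) (p v)" if uv: "(u, v) \<in> parcs G" for u v
    proof -
      have e: "{u, v} \<in> edges G" by (rule edgesI[OF uv])
      have V: "u \<in> pverts G" "v \<in> pverts G" "u \<noteq> v"
        using in_arcsD1[OF uv] in_arcsD2[OF uv] pair_no_loops[OF uv] by auto
      have d: "dist (p u) (x {u, v} u) = r" "dist (p v) (x {u, v} v) = r"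
        using B_D(6)[OF e] by auto
      have "p u \<noteq> x {u, v} u" "p v \<noteq> x {u, v} v" using d r(1) by auto
      then have "arc_between (B {u, v} \<union> (closed_segment (p u) (x {u, v} u) \<union> closed_segment (p v) (x {u, v} v))) (p u) (p v)"
        using arc_between_attach[OF arc_between_segment B_D(3)[OF uv] arc_between_segment
            seg[OF e] seg[OF e] B_D(2)[OF V] B_D(4)[OF e V(1)] B_D(4)[OF e V(2)]]
        by simp
      then show ?thesis by (simp add: A'_def)
    qed
    fix e assume e: "e \<in> edges G"
    show "A' e \<inter> p ` pverts G \<subseteq> p ` e"
    proof
      fix y assume "y \<in> A' e \<inter> p ` pverts G"
      then obtain w where w: "w \<in> pverts G" "y = p w" "y \<in> A' e" by blast
      then have "y \<in> cball (p w) r" using r(1) by simp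
      then show "y \<in> p ` e" using A1[OF e w(3) _ w(1)] w(2) by blast
    qed
    fix e' assume e': "e' \<in> edges G" and ne: "e \<noteq> e'"
    show "A' e \<inter> A' e' \<subseteq> p ` (e \<inter> e')"
    proof
      fix y assume y: "y \<in> A' e \<inter> A' e'"
      have "\<exists>w\<in>pverts G. y \<in> cball (p w) r"
        using A2[OF e] A2[OF e'] y B_D(7)[OF e e' ne] by blast
      then obtain w where w: "w \<in> pverts G" "y \<in> cball (p w) r" by blast
      have 1: "w \<in> e" "y \<in> closed_segment (p w) (x e w)" using A1[OF e _ w(2,1)] y by blast+
      have 2: "w \<in> e'" "y \<in> closed_segment (p w) (x e' w)" using A1[OF e' _ w(2,1)] y by blast+
      have "x e w \<in> B e" "x e' w \<in> B e'"
        using B_D(4)[OF e w(1) 1(1)] B_D(4)[OF e' w(1) 2(1)] by blast+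
      then have "x e w \<noteq> x e' w" using B_D(7)[OF e e' ne] by auto
      then have "y = p w"
        using radii_Int[OF B_D(6)[OF e 1(1)] B_D(6)[OF e' 2(1)]] 1(2) 2(2) by blast
      then show "y \<in> p ` (e \<inter> e')" using 1(1) 2(1) by blast
    qed
  qed
  \<comment> \<open>The tripod meets \<open>M\<close> only in its feet, so \<open>E i\<close> can
    meet the new drawing only inside the discs.\<close>
  have imM: "arcs_image G p A' \<subseteq> M"
  proof
    fix y assume "y \<in> arcs_image G p A'"
    then consider "y \<in> p ` pverts G" | e where "e \<in> edges G" "y \<in> A' e" unfolding arcs_image_def by blast
    then show "y \<in> M"
    proof cases
      case 1 then show ?thesis unfolding M_def K_def arcs_image_def by blast
    next
      case (2 e)
      then show ?thesis using A2[OF 2] BK[OF 2(1)] unfolding M_def by blast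
    qed
  qed
  show ?thesis
  proof (rule that[OF pA'])
    show "t \<notin> arcs_image G p A'" using imM t \<Omega>M by blast
    fix i assume i: "i \<in> I"
    note zi = z(2)[OF i]
    show "arc_between (E i) (p (a i)) t"
      unfolding E_def
    proof (rule arc_between_join[OF arc_between_segment T[OF i]])
      show "p (a i) \<noteq> z i" using zi r(1) by auto
      have "cball (p (a i)) r \<inter> \<Omega> = {}" using \<Omega>M assms(3)[OF i] unfolding M_def by blast
      then show "closed_segment (p (a i)) (z i) \<inter> T i = {z i}"
        using segz[OF i] T\<Omega>[OF i] arc_between_ends[OF T[OF i]] by auto
    qed
    show "E i \<inter> arcs_image G p A' \<subseteq> {p (a i)}"
    proof
      fix y assume y: "y \<in> E i \<inter> arcs_image G p A'"
      then have "y \<notin> \<Omega>" using imM \<Omega>M by blast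
      then obtain w where w: "w \<in> pverts G" "y \<in> cball (p w) r" using E2[OF i, of y] y by blast
      then have wi: "w = a i" "y \<in> closed_segment (p w) (z i)" using E1[OF i] y by blast+
      consider v where "v \<in> pverts G" "y = p v" | e where "e \<in> edges G" "y \<in> A' e"
        using y unfolding arcs_image_def by blast
      then show "y \<in> {p (a i)}"
      proof cases
        case (1 v)
        then have "y \<in> cball (p v) r" using r(1) by simp
        then have "v = a i" using E1[OF i _ _ 1(1)] y by blast
        then show ?thesis using 1 by simp
      next
        case (2 e)
        then have e: "w \<in> e" "y \<in> closed_segment (p w) (x e w)" using A1[OF 2 w(2,1)] by blast+
        have "x e w \<in> K" using B_D(4)[OF 2(1) w(1) e(1)] BK[OF 2(1)] by blast
        then have "x e w \<noteq> z i" using zi by auto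
        moreover have "dist (p w) (z i) = r" using zi wi(1) by simp
        ultimately have "y = p w" using radii_Int[OF B_D(6)[OF 2(1) e(1)]] wi(2) e(2) by blast
        then show ?thesis using wi(1) by simp
      qed
    qed
    fix j assume j: "j \<in> I" and ne: "i \<noteq> j"
    show "E i \<inter> E j \<subseteq> insert t ({p (a i)} \<inter> {p (a j)})"
    proof
      fix y assume y: "y \<in> E i \<inter> E j"
      show "y \<in> insert t ({p (a i)} \<inter> {p (a j)})"
      proof (cases "\<exists>w\<in>pverts G. y \<in> cball (p w) r")
        case True
        then obtain w where w: "w \<in> pverts G" "y \<in> cball (p w) r" by blast
        have 1: "w = a i" "y \<in> closed_segment (p w) (z i)" using E1[OF i _ w(2,1)] y by blast+
        have 2: "w = a j" "y \<in> closed_segment (p w) (z j)" using E1[OF j _ w(2,1)] y by blast+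
        have "z i \<noteq> z j" using z(1) i j ne by (auto simp: inj_on_def)
        moreover have "dist (p w) (z i) = r" using zi 1(1) by simp
        moreover have "dist (p w) (z j) = r" using z(2)[OF j] 2(1) by simp
        ultimately have "y = p w" using radii_Int[of "p w" "z i" r "z j"] 1(2) 2(2) by blast
        then show ?thesis using 1(1) 2(1) by simp
      next
        case False
        then have "y \<in> T i \<inter> T j" using E2[OF i] E2[OF j] y by blast
        then show ?thesis using TT[OF i j ne] by blast
      qed
    qed
  qed
qed

section \<open>Moving end points on a circle\<close>

text \<open>A drawing with further arcs \<open>E i\<close> that lead from the vertices \<open>a i\<close> to free points \<open>q i\<close>.
  Several of these arcs may start at the same vertex.\<close>
definition docked ::
  "'a pair_pre_digraph \<Rightarrow> ('a \<Rightarrow> complex) \<Rightarrow> ('a set \<Rightarrow> complex set) \<Rightarrow>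
    'i set \<Rightarrow> ('i \<Rightarrow> 'a) \<Rightarrow> ('i \<Rightarrow> complex) \<Rightarrow> ('i \<Rightarrow> complex set) \<Rightarrow> bool"
where
  "docked G p A I a q E \<longleftrightarrow> plane_arcs G p A \<and>
    (\<forall>i\<in>I. arc_between (E i) (p (a i)) (q i)) \<and>
    (\<forall>i\<in>I. E i \<inter> arcs_image G p A \<subseteq> {p (a i)}) \<and>
    (\<forall>i\<in>I. \<forall>j\<in>I. i \<noteq> j \<longrightarrow> E i \<inter> E j \<subseteq> {p (a i)} \<inter> {p (a j)})"

lemma dockedD:
  assumes "docked G p A I a q E"
  shows "plane_arcs G p A"
    and "i \<in> I \<Longrightarrow> arc_between (E i) (p (a i)) (q i)"
    and "i \<in> I \<Longrightarrow> E i \<inter> arcs_image G p A \<subseteq> {p (a i)}"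
    and "i \<in> I \<Longrightarrow> j \<in> I \<Longrightarrow> i \<noteq> j \<Longrightarrow> E i \<inter> E j \<subseteq> {p (a i)} \<inter> {p (a j)}"
  using assms unfolding docked_def by (simp_all del: Int_insert_left Int_insert_right)

lemma image_Int_subset:
  assumes "inj_on h S" "X \<subseteq> S" "Y \<subseteq> S" "X \<inter> Y \<subseteq> Z"
  shows "h ` X \<inter> h ` Y \<subseteq> h ` Z"
  using inj_on_image_Int[OF assms(1-3)] assms(4) by (metis image_mono)

lemma arcs_image_image: "arcs_image G (h \<circ> p) (\<lambda>e. h ` A e) = h ` arcs_image G p A"
  unfolding arcs_image_def by (simp add: image_Un image_UN image_comp)

lemma (in pair_graph) plane_arcs_image:
  assumes p: "plane_arcs G p A" and "continuous_on S h" "inj_on h S" "arcs_image G p A \<subseteq> S"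
  shows "plane_arcs G (h \<circ> p) (\<lambda>e. h ` A e)"
  unfolding plane_arcs_def
proof (intro conjI allI ballI impI)
  have pS: "p ` pverts G \<subseteq> S" and AS: "\<And>e. e \<in> edges G \<Longrightarrow> A e \<subseteq> S"
    using assms(4) unfolding arcs_image_def by blast+
  show "inj_on (h \<circ> p) (pverts G)"
    using plane_arcsD(1)[OF p] inj_on_subset[OF assms(3) pS] by (rule comp_inj_on)
  show "arc_between (h ` A {u, v}) ((h \<circ> p) u) ((h \<circ> p) v)" if "(u, v) \<in> parcs G" for u v
    using arc_between_image[OF plane_arcsD(2)[OF p that]] AS[OF edgesI[OF that]] assms(2,3)
    by (metis comp_apply continuous_on_subset inj_on_subset)
  fix e assume e: "e \<in> edges G"
  show "h ` A e \<inter> (h \<circ> p) ` pverts G \<subseteq> (h \<circ> p) ` e"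
    using image_Int_subset[OF assms(3) AS[OF e] pS plane_arcsD(3)[OF p e]] by (simp add: image_comp)
  fix e' assume e': "e' \<in> edges G" "e \<noteq> e'"
  show "h ` A e \<inter> h ` A e' \<subseteq> (h \<circ> p) ` (e \<inter> e')"
    using image_Int_subset[OF assms(3) AS[OF e] AS[OF e'(1)] plane_arcsD(4)[OF p e e']]
    by (simp add: image_comp)
qed

text \<open>Continuity and injectivity are required only on a set containing the drawing, so the map
  may have a pole off the drawing, as the inversion at the centre of the tripod has.\<close>

lemma (in pair_graph) docked_image:
  assumes d: "docked G p A I a q E" and "continuous_on S h" "inj_on h S"
    and "arcs_image G p A \<subseteq> S" "\<And>i. i \<in> I \<Longrightarrow> E i \<subseteq> S"
  shows "docked G (h \<circ> p) (\<lambda>e. h ` A e) I a (h \<circ> q) (\<lambda>i. h ` E i)"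
  unfolding docked_def
proof (intro conjI ballI impI)
  show "plane_arcs G (h \<circ> p) (\<lambda>e. h ` A e)"
    by (rule plane_arcs_image[OF dockedD(1)[OF d] assms(2-4)])
  fix i assume i: "i \<in> I"
  show "arc_between (h ` E i) ((h \<circ> p) (a i)) ((h \<circ> q) i)"
    using arc_between_image[OF dockedD(2)[OF d i]] assms(5)[OF i] assms(2,3)
    by (metis comp_apply continuous_on_subset inj_on_subset)
  show "h ` E i \<inter> arcs_image G (h \<circ> p) (\<lambda>e. h ` A e) \<subseteq> {(h \<circ> p) (a i)}"
    unfolding arcs_image_image
    using image_Int_subset[OF assms(3) assms(5)[OF i] assms(4) dockedD(3)[OF d i]] by simp
  fix j assume j: "j \<in> I" "i \<noteq> j"
  show "h ` E i \<inter> h ` E j \<subseteq> {(h \<circ> p) (a i)} \<inter> {(h \<circ> p) (a j)}"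
    using image_Int_subset[OF assms(3) assms(5)[OF i] assms(5)[OF j(1)] dockedD(4)[OF d i j]]
    by (auto simp del: Int_insert_left Int_insert_right)
qed

text \<open>Lifted angles of three points of the circle in counterclockwise order within one turn.
  These are strict linear inequalities between reals, so they persist under convex combinations;
  this keeps the rotating points apart.\<close>

definition cyclic3 :: "real \<Rightarrow> real \<Rightarrow> real \<Rightarrow> bool" where
  "cyclic3 a b c \<longleftrightarrow> a < b \<and> b < c \<and> c < a + 2 * pi"

lemma cis_neq:
  assumes "a < b" "b < a + 2 * pi"
  shows "cis a \<noteq> cis b"
proof
  assume "cis a = cis b"
  then have "cis (b - a) = 1" by (simp add: cis_divide[symmetric])
  then have "cos (b - a) = 1" by (metis cis.sel(1) one_complex.sel(1))
  then obtain n :: int where n: "b - a = of_int n * 2 * pi" unfolding cos_one_2pi_int by blast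
  then have "of_int n * (2 * pi) = b - a" by simp
  then have "0 < of_int n * (2 * pi)" "of_int n * (2 * pi) < 1 * (2 * pi)" using assms by linarith+
  then have "0 < real_of_int n" "real_of_int n < 1"
    using pi_gt_zero by (simp_all add: zero_less_mult_iff)
  then show False by simp
qed

lemma cyclic3_cis_neq:
  assumes "cyclic3 a b c"
  shows "cis a \<noteq> cis b" "cis a \<noteq> cis c" "cis b \<noteq> cis c"
  using assms cis_neq[of a b] cis_neq[of a c] cis_neq[of b c] unfolding cyclic3_def by auto

text \<open>Conjugation negates the angles and so reverses their order. Subtracting a full turn from
  \<open>- a\<close> makes that angle the smallest again.\<close>

lemma cyclic3_uminus: "cyclic3 a b c \<Longrightarrow> cyclic3 (- a - 2 * pi) (- c) (- b)"
  unfolding cyclic3_def by auto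

lemma convex_combination_less:
  assumes "0 \<le> s" "s \<le> 1" "a < b" "c < (d :: real)"
  shows "(1 - s) * a + s * c < (1 - s) * b + s * d"
proof (cases "s = 0")
  case False
  then have "s * c < s * d" "(1 - s) * a \<le> (1 - s) * b"
    using assms by (auto intro: mult_left_mono)
  then show ?thesis by simp
qed (use assms in simp)

lemma cyclic3_convex:
  assumes "cyclic3 a b c" "cyclic3 a' b' c'" "0 \<le> s" "s \<le> 1"
  shows "cyclic3 ((1 - s) * a + s * a') ((1 - s) * b + s * b') ((1 - s) * c + s * c')"
proof -
  have "(1 - s) * c + s * c' < (1 - s) * (a + 2 * pi) + s * (a' + 2 * pi)"
    using assms unfolding cyclic3_def by (intro convex_combination_less) auto
  also have "\<dots> = ((1 - s) * a + s * a') + 2 * pi" by (simp add: algebra_simps)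
  finally show ?thesis
    using assms unfolding cyclic3_def by (auto intro!: convex_combination_less)
qed

text \<open>Angles of \<open>y\<close> and \<open>z\<close> below \<open>Arg2pi x\<close> are raised
  by a full turn. Both then lie strictly within the turn after \<open>Arg2pi x\<close>, and
  comparing them gives the order.\<close>

lemma cyclic3_exists:
  assumes "norm x = 1" "norm y = 1" "norm z = 1" "x \<noteq> y" "x \<noteq> z" "y \<noteq> z"
  obtains a b c where "x = cis a" "y = cis b" "z = cis c" "cyclic3 a b c \<or> cyclic3 a c b"
proof -
  have ex: "\<exists>b. w = cis b \<and> Arg2pi x < b \<and> b < Arg2pi x + 2 * pi" if "norm w = 1" "w \<noteq> x" for w
  proof -
    have w: "w = cis (Arg2pi w)" and x: "x = cis (Arg2pi x)"
      using Arg2pi_eq[of w] Arg2pi_eq[of x] that assms(1) by (simp_all add: cis_conv_exp)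
    have ne: "Arg2pi w \<noteq> Arg2pi x" using w x that(2) by metis
    have b: "0 \<le> Arg2pi w" "Arg2pi w < 2 * pi" "0 \<le> Arg2pi x" "Arg2pi x < 2 * pi"
      using Arg2pi_ge_0 Arg2pi_lt_2pi by auto
    show ?thesis
    proof (cases "Arg2pi x < Arg2pi w")
      case True
      then show ?thesis using w b by (intro exI[of _ "Arg2pi w"]) auto
    next
      case False
      have "cis (Arg2pi w + 2 * pi) = w" using w by (simp add: cis_mult[symmetric])
      then show ?thesis using False ne b by (intro exI[of _ "Arg2pi w + 2 * pi"]) auto
    qed
  qed
  obtain b where b: "y = cis b" "Arg2pi x < b" "b < Arg2pi x + 2 * pi" using ex assms by metis
  obtain c where c: "z = cis c" "Arg2pi x < c" "c < Arg2pi x + 2 * pi" using ex assms by metis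
  have x: "x = cis (Arg2pi x)"
    using Arg2pi_eq[of x] assms(1) by (simp add: cis_conv_exp)
  have "b \<noteq> c" using b(1) c(1) assms(6) by auto
  then have "cyclic3 (Arg2pi x) b c \<or> cyclic3 (Arg2pi x) c b"
    using b c unfolding cyclic3_def by auto
  then show ?thesis using that x b(1) c(1) by blast
qed

text \<open>Complex conjugation reverses the cyclic order of three points of the circle, so one of the
  two maps below carries the first triple to a triple that can be rotated onto the second one
  without collisions.\<close>
lemma align_triples:
  fixes q x :: "'i \<Rightarrow> complex"
  assumes "card I = 3" "inj_on q I" "inj_on x I" "\<And>i. i \<in> I \<Longrightarrow> norm (q i) = 1" "\<And>i. i \<in> I \<Longrightarrow> norm (x i) = 1"
  obtains h \<theta> \<theta>' where "h = id \<or> h = cnj" "\<And>i. i \<in> I \<Longrightarrow> h (q i) = cis (\<theta> i)" "\<And>i. i \<in> I \<Longrightarrow> x i = cis (\<theta>' i)"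
    "\<And>i j s. i \<in> I \<Longrightarrow> j \<in> I \<Longrightarrow> i \<noteq> j \<Longrightarrow> 0 \<le> s \<Longrightarrow> s \<le> 1 \<Longrightarrow>
      cis ((1 - s) * \<theta> i + s * \<theta>' i) \<noteq> cis ((1 - s) * \<theta> j + s * \<theta>' j)"
proof -
  obtain i j k where I: "I = {i, j, k}" "i \<noteq> j" "i \<noteq> k" "j \<noteq> k"
    using assms(1) by (auto simp: card_3_iff)
  have II: "i \<in> I" "j \<in> I" "k \<in> I" using I by auto
  have qd: "q i \<noteq> q j" "q i \<noteq> q k" "q j \<noteq> q k" using I II assms(2) by (auto simp: inj_on_eq_iff)
  have xd: "x i \<noteq> x j" "x i \<noteq> x k" "x j \<noteq> x k" using I II assms(3) by (auto simp: inj_on_eq_iff)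
  obtain a b c where abc: "q i = cis a" "q j = cis b" "q k = cis c" "cyclic3 a b c \<or> cyclic3 a c b"
    by (rule cyclic3_exists[OF II[THEN assms(4)] qd])
  obtain a' b' c' where abc': "x i = cis a'" "x j = cis b'" "x k = cis c'" "cyclic3 a' b' c' \<or> cyclic3 a' c' b'"
    by (rule cyclic3_exists[OF II[THEN assms(5)] xd])
  have "\<exists>h a1 b1 c1. (h = id \<or> h = cnj) \<and> h (q i) = cis a1 \<and> h (q j) = cis b1 \<and> h (q k) = cis c1 \<and>
     (cyclic3 a1 b1 c1 \<and> cyclic3 a' b' c' \<or> cyclic3 a1 c1 b1 \<and> cyclic3 a' c' b')"
  proof (cases "cyclic3 a b c \<longleftrightarrow> cyclic3 a' b' c'")
    case True
    then have "cyclic3 a b c \<and> cyclic3 a' b' c' \<or> cyclic3 a c b \<and> cyclic3 a' c' b'"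
      using abc(4) abc'(4) by blast
    then show ?thesis using abc(1-3)
      by (intro exI[of _ id] exI[of _ a] exI[of _ b] exI[of _ c]) simp
  next
    case False
    then have "cyclic3 a c b \<and> cyclic3 a' b' c' \<or> cyclic3 a b c \<and> cyclic3 a' c' b'"
      using abc(4) abc'(4) by blast
    then have "cyclic3 (- a - 2 * pi) (- b) (- c) \<and> cyclic3 a' b' c' \<or>
        cyclic3 (- a - 2 * pi) (- c) (- b) \<and> cyclic3 a' c' b'"
      using cyclic3_uminus by blast
    moreover have "cis (- a - 2 * pi) = cis (- a)"
      unfolding cis_divide[symmetric] by simp
    then have "cnj (q i) = cis (- a - 2 * pi)" "cnj (q j) = cis (- b)" "cnj (q k) = cis (- c)"
      using abc(1-3) by (simp_all add: cis_cnj)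
    ultimately show ?thesis by blast
  qed
  then obtain h a1 b1 c1 where h: "h = id \<or> h = cnj" "h (q i) = cis a1" "h (q j) = cis b1" "h (q k) = cis c1"
     and c: "cyclic3 a1 b1 c1 \<and> cyclic3 a' b' c' \<or> cyclic3 a1 c1 b1 \<and> cyclic3 a' c' b'"
    by blast
  define \<theta> where "\<theta> = (\<lambda>l. if l = i then a1 else if l = j then b1 else c1)"
  define \<theta>' where "\<theta>' = (\<lambda>l. if l = i then a' else if l = j then b' else c')"
  have [simp]: "\<theta> i = a1" "\<theta> j = b1" "\<theta> k = c1" "\<theta>' i = a'" "\<theta>' j = b'" "\<theta>' k = c'"
    using I by (auto simp: \<theta>_def \<theta>'_def)
  show ?thesis
  proof (rule that[OF h(1), of \<theta> \<theta>'])
    fix l assume l: "l \<in> I"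
    show "h (q l) = cis (\<theta> l)" using l I(1) h by auto
    show "x l = cis (\<theta>' l)" using l I(1) abc' by auto
    fix m s assume m: "m \<in> I" "l \<noteq> m" and s: "0 \<le> s" "s \<le> (1::real)"
    let ?w = "\<lambda>l. cis ((1 - s) * \<theta> l + s * \<theta>' l)"
    have "?w i \<noteq> ?w j \<and> ?w i \<noteq> ?w k \<and> ?w j \<noteq> ?w k"
      using c
    proof
      assume "cyclic3 a1 b1 c1 \<and> cyclic3 a' b' c'"
      then show ?thesis
        using cyclic3_cis_neq[OF cyclic3_convex[of a1 b1 c1 a' b' c' s]] s by simp
    next
      assume "cyclic3 a1 c1 b1 \<and> cyclic3 a' c' b'"
      then show ?thesis
        using cyclic3_cis_neq[OF cyclic3_convex[of a1 c1 b1 a' c' b' s]] s by simp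
    qed
    moreover define W where "W = ?w"
    ultimately have "W i \<noteq> W j" "W i \<noteq> W k" "W j \<noteq> W k" by simp_all
    then have "W l \<noteq> W m" using l m I(1) by (metis empty_iff insert_iff)
    then show "?w l \<noteq> ?w m" unfolding W_def .
  qed
qed

text \<open>The modulus \<open>(1 + s) / 2\<close> crosses the annulus from \<open>1 / 2\<close> to
  \<open>1\<close> and records the time \<open>s\<close> of a rotation from \<open>\<theta>\<close>
  to \<open>\<theta>'\<close>. Two spirals can therefore meet only where the rotating points collide
  at the same time.\<close>

definition spiral :: "real \<Rightarrow> real \<Rightarrow> complex set" where
  "spiral \<theta> \<theta>' = (\<lambda>s. of_real ((1 + s) / 2) * cis ((1 - s) * \<theta> + s * \<theta>')) ` {0..1}"

lemma norm_spiral_point: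
  "0 \<le> s \<Longrightarrow> norm (of_real ((1 + s) / 2) * cis t) = (1 + s) / 2"
  unfolding norm_mult norm_of_real norm_cis by simp

lemma arc_between_spiral: "arc_between (spiral \<theta> \<theta>') (cis \<theta> / 2) (cis \<theta>')"
proof -
  let ?f = "\<lambda>s. of_real ((1 + s) / 2) * cis ((1 - s) * \<theta> + s * \<theta>')"
  have "arc_between {0..1} 0 (1::real)"
    using arc_between_segment[of 0 "1::real"] by (simp add: closed_segment_eq_real_ivl)
  moreover have "continuous_on {0..1} ?f"
    by (intro continuous_intros) auto
  moreover have "inj_on ?f {0..1}"
  proof (rule inj_onI)
    fix s t :: real assume "s \<in> {0..1}" "t \<in> {0..1}" "?f s = ?f t"
    then have "(1 + s) / 2 = (1 + t) / 2" by (metis norm_spiral_point atLeastAtMost_iff)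
    then show "s = t" by simp
  qed
  ultimately have "arc_between (?f ` {0..1}) (?f 0) (?f 1)" by (rule arc_between_image)
  then show ?thesis by (simp add: spiral_def)
qed

lemma spiral_norm:
  assumes "z \<in> spiral \<theta> \<theta>'"
  shows "1 / 2 \<le> norm z" "norm z \<le> 1"
    and "norm z = 1 / 2 \<Longrightarrow> z = cis \<theta> / 2" "norm z = 1 \<Longrightarrow> z = cis \<theta>'"
proof -
  obtain s where s: "0 \<le> s" "s \<le> 1" "z = of_real ((1 + s) / 2) * cis ((1 - s) * \<theta> + s * \<theta>')"
    using assms unfolding spiral_def by auto
  then have n: "norm z = (1 + s) / 2" using norm_spiral_point by metis
  show "1 / 2 \<le> norm z" "norm z \<le> 1" using s n by auto
  show "z = cis \<theta> / 2" if "norm z = 1 / 2"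
  proof -
    have "s = 0" using n that by simp
    then show ?thesis using s(3) by simp
  qed
  show "z = cis \<theta>'" if "norm z = 1"
  proof -
    have "s = 1" using n that by simp
    then show ?thesis using s(3) by simp
  qed
qed

lemma spiral_disjoint:
  assumes "\<And>s. 0 \<le> s \<Longrightarrow> s \<le> 1 \<Longrightarrow>
      cis ((1 - s) * \<theta> + s * \<theta>') \<noteq> cis ((1 - s) * \<eta> + s * \<eta>')"
  shows "spiral \<theta> \<theta>' \<inter> spiral \<eta> \<eta>' = {}"
proof -
  have False if z: "z \<in> spiral \<theta> \<theta>'" "z \<in> spiral \<eta> \<eta>'" for z
  proof -
    obtain s where s: "0 \<le> s" "s \<le> 1" "z = of_real ((1 + s) / 2) * cis ((1 - s) * \<theta> + s * \<theta>')"
      using z(1) unfolding spiral_def by auto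
    obtain t where t: "0 \<le> t" "t \<le> 1" "z = of_real ((1 + t) / 2) * cis ((1 - t) * \<eta> + t * \<eta>')"
      using z(2) unfolding spiral_def by auto
    have "(1 + s) / 2 = (1 + t) / 2" using s t norm_spiral_point by metis
    then have "s = t" by simp
    moreover have "complex_of_real ((1 + s) / 2) \<noteq> 0"
      using s(1) unfolding of_real_eq_0_iff by simp
    ultimately have "cis ((1 - s) * \<theta> + s * \<theta>') = cis ((1 - s) * \<eta> + s * \<eta>')"
      using s(3) t(3) mult_cancel_left by metis
    then show False using assms s by blast
  qed
  then show ?thesis by blast
qed

section \<open>Drawings in a disc\<close>

text \<open>The legs of the tripod are cut at their first entrance into a small disc around the
  centre \<open>t\<close>, which the drawing avoids. The entry points differ because, apart from
  \<open>t\<close>, two legs meet only at vertices, hence outside this disc.\<close>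

lemma (in pair_graph) outerplanar_docked_sphere:
  assumes "outerplanar G" "card I = 3" "\<And>i. i \<in> I \<Longrightarrow> a i \<in> pverts G"
  obtains p A E q t r where "docked G p A I a q E" "inj_on q I" "0 < r"
    "arcs_image G p A \<inter> cball t r = {}" "\<And>i. i \<in> I \<Longrightarrow> E i \<inter> cball t r = {q i}"
    "\<And>i. i \<in> I \<Longrightarrow> dist t (q i) = r"
proof -
  obtain p A t E where p: "plane_arcs G p A" and t: "t \<notin> arcs_image G p A"
    and arc: "\<And>i. i \<in> I \<Longrightarrow> arc_between (E i) (p (a i)) t"
    and im: "\<And>i. i \<in> I \<Longrightarrow> E i \<inter> arcs_image G p A \<subseteq> {p (a i)}"
    and EE: "\<And>i j. i \<in> I \<Longrightarrow> j \<in> I \<Longrightarrow> i \<noteq> j \<Longrightarrow> E i \<inter> E j \<subseteq> insert t ({p (a i)} \<inter> {p (a j)})"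
    by (rule outerplanar_tripod[OF assms]) blast+
  have cl: "closed (arcs_image G p A)"
    using compact_arcs_image[OF p] by (rule compact_imp_closed)
  from eventually_happens'[OF _ eventually_conj[OF eventually_at_right_0_less[OF zero_less_one]
        eventually_cball_disjoint[OF cl t]]]
  obtain r where r: "0 < r" "arcs_image G p A \<inter> cball t r = {}"
    by (auto simp: trivial_limit_at_right_real)
  have pim: "p (a i) \<in> arcs_image G p A" if "i \<in> I" for i
    using assms(3)[OF that] unfolding arcs_image_def by blast
  have "\<exists>T y. arc_between T (p (a i)) y \<and> T \<subseteq> E i \<and> T \<inter> cball t r = {y}" if i: "i \<in> I" for i
  proof -
    have "{p (a i)} \<inter> cball t r = {}" using r(2) pim[OF i] by blast
    then obtain T x y where T: "arc_between T x y" "T \<subseteq> E i" "T \<inter> {p (a i)} = {x}" "T \<inter> cball t r = {y}"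
      using arc_between_truncate[OF arc[OF i], of "{p (a i)}" "cball t r"] r(1) by auto
    have "x = p (a i)" using T(3) by blast
    then show ?thesis using T by blast
  qed
  then obtain T y where T: "\<And>i. i \<in> I \<Longrightarrow> arc_between (T i) (p (a i)) (y i)"
      and TE: "\<And>i. i \<in> I \<Longrightarrow> T i \<subseteq> E i" and Tc: "\<And>i. i \<in> I \<Longrightarrow> T i \<inter> cball t r = {y i}"
    by metis
  have y: "dist t (y i) = r" if "i \<in> I" for i
    using arc_between_touch_sphere[OF arc_between_sym[OF T] Tc] that by blast
  have tT: "t \<notin> T i" if i: "i \<in> I" for i
  proof
    assume "t \<in> T i"
    then have "t \<in> T i \<inter> cball t r" using r(1) by simp
    then have "t = y i" using Tc[OF i] by blast
    then show False using y[OF i] r(1) by simp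
  qed
  have TT: "T i \<inter> T j \<subseteq> {p (a i)} \<inter> {p (a j)}" if "i \<in> I" "j \<in> I" "i \<noteq> j" for i j
    using EE[OF that] TE[OF that(1)] TE[OF that(2)] tT[OF that(1)] by blast
  show ?thesis
  proof (rule that[OF _ _ r Tc y])
    show "docked G p A I a y T"
      unfolding docked_def using p T TT im TE by blast
    show "inj_on y I"
    proof (rule inj_onI, rule ccontr)
      fix i j assume ij: "i \<in> I" "j \<in> I" "y i = y j" "i \<noteq> j"
      have 1: "y i \<in> T i" "y j \<in> T j" "y i \<in> cball t r" using Tc[OF ij(1)] Tc[OF ij(2)] by blast+
      then have "y i = p (a i)" using TT[OF ij(1,2,4)] ij(3) by auto
      then show False using pim[OF ij(1)] 1(3) r(2) by auto
    qed
  qed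
qed

lemma (in pair_graph) outerplanar_docked_half:
  assumes "outerplanar G" "card I = 3" "\<And>i. i \<in> I \<Longrightarrow> a i \<in> pverts G"
  obtains p A E q where "docked G p A I a q E" "inj_on q I"
    "arcs_image G p A \<subseteq> ball 0 (1 / 2)" "\<And>i. i \<in> I \<Longrightarrow> E i \<subseteq> insert (q i) (ball 0 (1 / 2))"
    "\<And>i. i \<in> I \<Longrightarrow> norm (q i) = 1 / 2"
proof -
  obtain p A E q t r where d: "docked G p A I a q E" and q: "inj_on q I" and r: "0 < r"
    and im: "arcs_image G p A \<inter> cball t r = {}"
    and Ec: "\<And>i. i \<in> I \<Longrightarrow> E i \<inter> cball t r = {q i}" and qt: "\<And>i. i \<in> I \<Longrightarrow> dist t (q i) = r"
    by (rule outerplanar_docked_sphere[OF assms]) blast+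
  \<comment> \<open>The circle of radius \<open>r\<close> around the pole \<open>t\<close> goes to
    the circle of radius \<open>1 / 2\<close>, and its exterior goes inside. The factor
    \<open>r / 2\<close> leaves the annulus up to radius \<open>1\<close> free for the
    spirals.\<close>
  define h where "h = (\<lambda>w. of_real (r / 2) / (w - t))"
  have hn: "norm (h w) = (r / 2) / dist t w" for w
    unfolding h_def norm_divide norm_of_real using r by (simp add: dist_norm norm_minus_commute)
  have hb: "h w \<in> ball 0 (1 / 2)" if "w \<notin> cball t r" for w
    using that r by (simp add: hn divide_simps del: divide_numeral_1)
  have cont: "continuous_on (- {t}) h"
    unfolding h_def by (intro continuous_intros) auto
  have inj: "inj_on h (- {t})"
  proof (rule inj_onI)
    fix v w assume "v \<in> - {t}" "w \<in> - {t}" "h v = h w"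
    then show "v = w" using r by (simp add: h_def divide_simps)
  qed
  have im': "arcs_image G p A \<subseteq> - {t}" using im r by auto
  have E': "E i \<subseteq> - {t}" if i: "i \<in> I" for i
  proof -
    have "t \<notin> E i"
    proof
      assume "t \<in> E i"
      then have "t \<in> E i \<inter> cball t r" using r by simp
      then have "t = q i" using Ec[OF i] by blast
      then show False using qt[OF i] r by simp
    qed
    then show ?thesis by blast
  qed
  show ?thesis
  proof (rule that[OF docked_image[OF d cont inj im' E']])
    have "q i \<noteq> t" if "i \<in> I" for i using qt[OF that] r by auto
    then have "q ` I \<subseteq> - {t}" by blast
    then show "inj_on (h \<circ> q) I" using q inj inj_on_subset comp_inj_on by blast
    show "arcs_image G (h \<circ> p) (\<lambda>e. h ` A e) \<subseteq> ball 0 (1 / 2)"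
      unfolding arcs_image_image using hb im by blast
    fix i assume i: "i \<in> I"
    show "h ` E i \<subseteq> insert ((h \<circ> q) i) (ball 0 (1 / 2))"
    proof clarify
      fix w assume w: "w \<in> E i" "h w \<notin> ball 0 (1 / 2)"
      then have "w \<in> E i \<inter> cball t r" using hb by blast
      then have "w = q i" using Ec[OF i] by blast
      then show "h w = (h \<circ> q) i" by simp
    qed
    show "norm ((h \<circ> q) i) = 1 / 2" using qt[OF i] r hn by simp
  qed
qed

lemma (in pair_graph) outerplanar_docked3:
  assumes "outerplanar G" "card I = 3" "\<And>i. i \<in> I \<Longrightarrow> a i \<in> pverts G"
    and "inj_on x I" "\<And>i. i \<in> I \<Longrightarrow> norm (x i) = 1"
  obtains p A E where "docked G p A I a x E" "arcs_image G p A \<subseteq> ball 0 1"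
    "\<And>i. i \<in> I \<Longrightarrow> E i \<subseteq> insert (x i) (ball 0 1)"
proof -
  obtain p A E q where d: "docked G p A I a q E" and q: "inj_on q I"
    and im: "arcs_image G p A \<subseteq> ball 0 (1 / 2)"
    and E: "\<And>i. i \<in> I \<Longrightarrow> E i \<subseteq> insert (q i) (ball 0 (1 / 2))"
    and nq: "\<And>i. i \<in> I \<Longrightarrow> norm (q i) = 1 / 2"
    by (rule outerplanar_docked_half[OF assms(1-3)]) blast+
  \<comment> \<open>\<open>align_triples\<close> speaks of the unit circle, hence the factor
    \<open>2\<close>; both \<open>id\<close> and \<open>cnj\<close> commute with it.\<close>
  have "inj_on (\<lambda>i. 2 * q i) I" using q by (auto simp: inj_on_def)
  moreover have "norm (2 * q i) = 1" if "i \<in> I" for i using nq[OF that] by (simp add: norm_mult)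
  ultimately obtain h \<theta> \<theta>' where h: "h = id \<or> h = cnj" "\<And>i. i \<in> I \<Longrightarrow> h (2 * q i) = cis (\<theta> i)"
    and x: "\<And>i. i \<in> I \<Longrightarrow> x i = cis (\<theta>' i)"
    and cd: "\<And>i j s. i \<in> I \<Longrightarrow> j \<in> I \<Longrightarrow> i \<noteq> j \<Longrightarrow> 0 \<le> s \<Longrightarrow> s \<le> 1 \<Longrightarrow>
      cis ((1 - s) * \<theta> i + s * \<theta>' i) \<noteq> cis ((1 - s) * \<theta> j + s * \<theta>' j)"
    using align_triples[OF assms(2) _ assms(4) _ assms(5), of "\<lambda>i. 2 * q i"] by blast
  have hq: "h (q i) = cis (\<theta> i) / 2" if "i \<in> I" for i
  proof -
    have "h (2 * q i) = 2 * h (q i)" using h(1) by auto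
    then show ?thesis using h(2)[OF that] by simp
  qed
  have hn: "norm (h w) = norm w" for w using h(1) by auto
  have "continuous_on UNIV h" using h(1) by (auto intro: continuous_intros)
  moreover have inj: "inj_on h UNIV" using h(1) by (auto simp: inj_on_def)
  ultimately have d': "docked G (h \<circ> p) (\<lambda>e. h ` A e) I a (h \<circ> q) (\<lambda>i. h ` E i)"
    by (rule docked_image[OF d]) auto
  note D = dockedD[OF d']
  have im': "arcs_image G (h \<circ> p) (\<lambda>e. h ` A e) \<subseteq> ball 0 (1 / 2)"
    unfolding arcs_image_image using im hn by auto
  define \<sigma> where "\<sigma> = (\<lambda>i. spiral (\<theta> i) (\<theta>' i))"
  define \<delta> where "\<delta> = (\<lambda>i. h ` E i \<union> \<sigma> i)"
  have hE: "y = cis (\<theta> i) / 2 \<or> norm y < 1 / 2" if i: "i \<in> I" and y: "y \<in> h ` E i" for i y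
  proof -
    obtain w where w: "w \<in> E i" "y = h w" using y by blast
    then consider "w = q i" | "norm w < 1 / 2" using E[OF i] by auto
    then show ?thesis using hq[OF i] hn w(2) by cases auto
  qed
  \<comment> \<open>The arcs stay in the closed disc of radius \<open>1 / 2\<close> and the spirals
    in the annulus; on the common circle each has a single point.\<close>
  have E\<sigma>: "y = cis (\<theta> i) / 2" "y = cis (\<theta> j) / 2"
    if i: "i \<in> I" "j \<in> I" and y: "y \<in> h ` E i" "y \<in> \<sigma> j" for i j y
  proof -
    have n: "1 / 2 \<le> norm y" using spiral_norm(1) y(2) unfolding \<sigma>_def by blast
    then show 1: "y = cis (\<theta> i) / 2" using hE[OF i(1) y(1)] by auto
    have "norm (cis (\<theta> i) / 2) = 1 / 2" unfolding norm_divide norm_cis by simp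
    then have "norm y = 1 / 2" unfolding 1 .
    then show "y = cis (\<theta> j) / 2" using spiral_norm(3) y(2) unfolding \<sigma>_def by blast
  qed
  have ne: "cis (\<theta> i) \<noteq> cis (\<theta> j)" if "i \<in> I" "j \<in> I" "i \<noteq> j" for i j
    using cd[OF that, of 0] by simp
  have "docked G (h \<circ> p) (\<lambda>e. h ` A e) I a x \<delta>"
    unfolding docked_def
  proof (intro conjI ballI impI)
    show "plane_arcs G (h \<circ> p) (\<lambda>e. h ` A e)" by (rule D(1))
    fix i assume i: "i \<in> I"
    have 1: "arc_between (h ` E i) ((h \<circ> p) (a i)) (cis (\<theta> i) / 2)"
      using D(2)[OF i] hq[OF i] by simp
    have 2: "arc_between (\<sigma> i) (cis (\<theta> i) / 2) (x i)"
      unfolding \<sigma>_def x[OF i] by (rule arc_between_spiral)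
    have "h ` E i \<inter> \<sigma> i \<subseteq> {cis (\<theta> i) / 2}" using E\<sigma>[OF i i] by blast
    moreover have "cis (\<theta> i) / 2 \<in> h ` E i \<inter> \<sigma> i"
      using arc_between_ends[OF 1] arc_between_ends[OF 2] by blast
    ultimately have "h ` E i \<inter> \<sigma> i = {cis (\<theta> i) / 2}" by blast
    then show "arc_between (\<delta> i) ((h \<circ> p) (a i)) (x i)"
      unfolding \<delta>_def by (rule arc_between_join[OF 1 2])
    have "y \<notin> arcs_image G (h \<circ> p) (\<lambda>e. h ` A e)" if "y \<in> \<sigma> i" for y
      using spiral_norm(1)[of y "\<theta> i" "\<theta>' i"] that im' unfolding \<sigma>_def by auto
    then show "\<delta> i \<inter> arcs_image G (h \<circ> p) (\<lambda>e. h ` A e) \<subseteq> {(h \<circ> p) (a i)}"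
      using D(3)[OF i] unfolding \<delta>_def by blast
    fix j assume j: "j \<in> I" "i \<noteq> j"
    have "\<sigma> i \<inter> \<sigma> j = {}"
      unfolding \<sigma>_def using cd[OF i j] by (intro spiral_disjoint) blast
    moreover have "h ` E i \<inter> \<sigma> j = {}" "h ` E j \<inter> \<sigma> i = {}"
      using E\<sigma>[OF i j(1)] E\<sigma>[OF j(1) i] ne[OF i j] by fastforce+
    ultimately have "\<delta> i \<inter> \<delta> j \<subseteq> h ` E i \<inter> h ` E j" unfolding \<delta>_def by blast
    then show "\<delta> i \<inter> \<delta> j \<subseteq> {(h \<circ> p) (a i)} \<inter> {(h \<circ> p) (a j)}" using D(4)[OF i j] by blast
  qed
  moreover have "ball 0 (1 / 2) \<subseteq> ball (0 :: complex) 1" by (intro subset_ball) simp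
  then have "arcs_image G (h \<circ> p) (\<lambda>e. h ` A e) \<subseteq> ball 0 1" using im' by blast
  moreover have "\<delta> i \<subseteq> insert (x i) (ball 0 1)" if i: "i \<in> I" for i
  proof
    fix y assume "y \<in> \<delta> i"
    then consider "y \<in> h ` E i" | "y \<in> \<sigma> i" unfolding \<delta>_def by blast
    then show "y \<in> insert (x i) (ball 0 1)"
    proof cases
      case 1
      have "norm (cis (\<theta> i) / 2) < 1" unfolding norm_divide norm_cis by simp
      moreover have "norm y < 1" if "norm y < 1 / 2" using that by simp
      ultimately have "norm y < 1" using hE[OF i 1] by metis
      then show ?thesis by simp
    next
      case 2
      then show ?thesis
        using spiral_norm(2,4)[of y "\<theta> i" "\<theta>' i"] x[OF i] unfolding \<sigma>_def by force
    qed
  qed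
  ultimately show ?thesis using that by blast
qed

text \<open>Fewer than three targets are filled up to exactly three by points \<open>Y\<close> of
  the circle, whose arcs start at an arbitrary vertex \<open>v\<close> and are dropped at the end.
  The targets, scaled to the unit circle, serve as their own index set \<open>Z\<close>, so the
  padding needs no new indices.\<close>

lemma (in pair_graph) outerplanar_docked:
  assumes "outerplanar G" "pverts G \<noteq> {}" "finite I" "card I \<le> 3" "\<And>i. i \<in> I \<Longrightarrow> a i \<in> pverts G"
    and "inj_on x I" "\<And>i. i \<in> I \<Longrightarrow> dist c (x i) = r" "0 < r"
  obtains p A E where "docked G p A I a x E" "arcs_image G p A \<subseteq> ball c r"
    "\<And>i. i \<in> I \<Longrightarrow> E i \<subseteq> insert (x i) (ball c r)"
proof -
  define X where "X = (\<lambda>i. (x i - c) / of_real r)"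
  define h where "h = (\<lambda>w. c + of_real r * w)"
  have hX: "h (X i) = x i" for i using assms(8) by (simp add: h_def X_def)
  have X1: "norm (X i) = 1" if "i \<in> I" for i
    using assms(7)[OF that] assms(8) by (simp add: X_def norm_divide dist_norm norm_minus_commute)
  have injX: "inj_on X I"
    using assms(6) hX by (metis inj_on_def)
  have "infinite (sphere (0::complex) 1 - X ` I)"
    using infinite_sphere_Int_ball[of 0 "1::complex" 1 1] assms(3)
    by (intro Diff_infinite_finite) (auto dest: finite_subset[rotated])
  then obtain Y where Y: "finite Y" "card Y = 3 - card I" "Y \<subseteq> sphere 0 1 - X ` I"
    using infinite_arbitrarily_large by blast
  define Z where "Z = X ` I \<union> Y"
  have "card Z = card (X ` I) + card Y"
    unfolding Z_def using Y assms(3) by (intro card_Un_disjoint) auto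
  then have cZ: "card Z = 3" using Y(2) assms(4) card_image[OF injX] by simp
  have Z1: "norm z = 1" if "z \<in> Z" for z using that X1 Y(3) unfolding Z_def by auto
  obtain v where v: "v \<in> pverts G" using assms(2) by blast
  define a' where "a' = (\<lambda>z. if z \<in> X ` I then a (inv_into I X z) else v)"
  have aV: "a' z \<in> pverts G" for z
    unfolding a'_def using v assms(5) inv_into_into by (metis (full_types))
  have a'X: "a' (X i) = a i" if "i \<in> I" for i
    unfolding a'_def using that injX by simp
  obtain p A E where d: "docked G p A Z a' (\<lambda>z. z) E" and im: "arcs_image G p A \<subseteq> ball 0 1"
    and E: "\<And>z. z \<in> Z \<Longrightarrow> E z \<subseteq> insert z (ball 0 1)"
    using outerplanar_docked3[OF assms(1) cZ, of a' "\<lambda>z. z"] aV Z1 by (auto simp: inj_on_def)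
  have "continuous_on UNIV h" unfolding h_def by (intro continuous_intros)
  moreover have "inj_on h UNIV" using assms(8) by (auto simp: h_def inj_on_def)
  ultimately have "docked G (h \<circ> p) (\<lambda>e. h ` A e) Z a' (h \<circ> (\<lambda>z. z)) (\<lambda>z. h ` E z)"
    by (rule docked_image[OF d]) auto
  note D = dockedD[OF this]
  have hb: "h w \<in> ball c r" if "w \<in> ball 0 1" for w
    using that assms(8) by (simp add: h_def dist_norm norm_mult)
  have XZ: "X i \<in> Z" if "i \<in> I" for i using that unfolding Z_def by blast
  show ?thesis
  proof (rule that)
    show "docked G (h \<circ> p) (\<lambda>e. h ` A e) I a x (\<lambda>i. h ` E (X i))"
      unfolding docked_def
    proof (intro conjI ballI impI)
      show "plane_arcs G (h \<circ> p) (\<lambda>e. h ` A e)" by (rule D(1))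
      fix i assume i: "i \<in> I"
      show "arc_between (h ` E (X i)) ((h \<circ> p) (a i)) (x i)"
        using D(2)[OF XZ[OF i]] a'X[OF i] hX by simp
      show "h ` E (X i) \<inter> arcs_image G (h \<circ> p) (\<lambda>e. h ` A e) \<subseteq> {(h \<circ> p) (a i)}"
        using D(3)[OF XZ[OF i]] unfolding a'X[OF i] .
      fix j assume j: "j \<in> I" "i \<noteq> j"
      have "X i \<noteq> X j" using injX i j by (auto simp: inj_on_def)
      from D(4)[OF XZ[OF i] XZ[OF j(1)] this]
      show "h ` E (X i) \<inter> h ` E (X j) \<subseteq> {(h \<circ> p) (a i)} \<inter> {(h \<circ> p) (a j)}"
        unfolding a'X[OF i] a'X[OF j(1)] .
    qed
    show "arcs_image G (h \<circ> p) (\<lambda>e. h ` A e) \<subseteq> ball c r"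
      unfolding arcs_image_image using im hb by blast
    show "h ` E (X i) \<subseteq> insert (x i) (ball c r)" if i: "i \<in> I" for i
      using E[OF XZ[OF i]] hb hX[of i] by blast
  qed
qed

section \<open>Planarity of the product\<close>

theorem theorem2p14:
  fixes G :: "'a pair_pre_digraph" and H :: "'b pair_pre_digraph" and f :: "'a \<Rightarrow> 'b"
  assumes "pair_graph G" and "pair_graph H"
    and "Digraph_Component.connected (with_proj G)"
    and "Digraph_Component.connected (with_proj H)"
    and "f \<in> pverts G \<rightarrow> pverts H"
    and "planar G" and "max_degree G \<le> 3" and "outerplanar H"
  shows "planar (sierpinski_product G f H)"
proof -
  interpret G: pair_graph G by fact
  interpret H: pair_graph H by fact
  obtain p A where pA: "plane_arcs G p A"
    using assms(6) plane_drawing_imp_plane_arcs unfolding planar_def by blast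
  from eventually_happens'[OF _ G.eventually_disc_arcs[OF pA]]
  obtain r x B where B: "disc_arcs G p r x B"
    by (auto simp: trivial_limit_at_right_real)
  note B_D = disc_arcsD[OF B]
  note r = B_D(1)

  \<comment> \<open>A drawing of \<open>H\<close> in the disc of every vertex of
    \<open>G\<close>\<close>
  define N where "N = (\<lambda>g. {g'. (g, g') \<in> parcs G})"
  have N: "finite (N g)" "card (N g) \<le> 3" if g: "g \<in> pverts G" for g
  proof -
    have eq: "out_arcs (with_proj G) g = Pair g ` N g" by (auto simp: out_arcs_def N_def)
    have "finite (out_arcs (with_proj G) g)"
      using G.pair_finite_arcs by (simp add: out_arcs_def)
    then show "finite (N g)" unfolding eq by (rule finite_imageD) (simp add: inj_on_def)
    have "card (N g) = out_degree (with_proj G) g"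
      unfolding out_degree_def eq by (simp add: card_image inj_on_def)
    also have "\<dots> \<le> max_degree G"
      unfolding max_degree_def using G.pair_finite_verts g by (intro cSUP_upper bdd_above_finite) auto
    finally show "card (N g) \<le> 3" using assms(7) by simp
  qed
  have f: "f g \<in> pverts H" if "g \<in> pverts G" for g using assms(5) that by blast
  have NV: "g' \<in> pverts G \<and> g' \<noteq> g \<and> g \<in> pverts G" if "g' \<in> N g" for g g'
    using that G.in_arcsD1 G.in_arcsD2 G.pair_no_loops unfolding N_def by fastforce
  have Nsym: "g \<in> N g'" if "g' \<in> N g" for g g'
    using that G.graph_symmetric unfolding N_def by auto
  have Ne: "{g, g'} \<in> edges G" if "g' \<in> N g" for g g'
    using that edgesI unfolding N_def by fast
  have xB: "B {g, g'} \<inter> cball (p g) r = {x {g, g'} g}" if "g' \<in> N g" for g g'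
    using B_D(4)[OF Ne[OF that], of g] NV[OF that] by simp
  \<comment> \<open>The arc for the neighbour \<open>g'\<close> starts at \<open>f g'\<close>, since
    the edge towards the copy at \<open>g'\<close> leaves the copy at \<open>g\<close> there, and it
    ends at the cut point of the edge \<open>{g, g'}\<close> of \<open>G\<close>.\<close>
  have "\<exists>P \<Gamma> \<delta>. docked H P \<Gamma> (N g) f (\<lambda>g'. x {g, g'} g) \<delta> \<and> arcs_image H P \<Gamma> \<subseteq> ball (p g) r \<and>
      (\<forall>g'\<in>N g. \<delta> g' \<subseteq> insert (x {g, g'} g) (ball (p g) r))" if g: "g \<in> pverts G" for g
  proof -
    have "inj_on (\<lambda>g'. x {g, g'} g) (N g)"
    proof (rule inj_onI, rule ccontr)
      fix u v assume uv: "u \<in> N g" "v \<in> N g" "x {g, u} g = x {g, v} g" "u \<noteq> v"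
      then have "{g, u} \<noteq> {g, v}" by (simp add: doubleton_eq_iff)
      then have "B {g, u} \<inter> B {g, v} = {}" using B_D(7) Ne uv(1,2) by blast
      then show False using xB[OF uv(1)] xB[OF uv(2)] uv(3) by auto
    qed
    moreover have "dist (p g) (x {g, g'} g) = r" if "g' \<in> N g" for g'
      using B_D(6)[OF Ne[OF that]] by simp
    moreover have "pverts H \<noteq> {}" using f[OF g] by blast
    moreover have "f g' \<in> pverts H" if "g' \<in> N g" for g' using f NV[OF that] by blast
    ultimately show ?thesis
      using H.outerplanar_docked[OF assms(8) _ N[OF g], of f "\<lambda>g'. x {g, g'} g" "p g" r] r
      by metis
  qed
  then obtain P \<Gamma> \<delta> where docked: "\<And>g. g \<in> pverts G \<Longrightarrow> docked H (P g) (\<Gamma> g) (N g) f (\<lambda>g'. x {g, g'} g) (\<delta> g)"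
    and im: "\<And>g. g \<in> pverts G \<Longrightarrow> arcs_image H (P g) (\<Gamma> g) \<subseteq> ball (p g) r"
    and \<delta>: "\<And>g g'. g \<in> pverts G \<Longrightarrow> g' \<in> N g \<Longrightarrow> \<delta> g g' \<subseteq> insert (x {g, g'} g) (ball (p g) r)"
    by metis
  note D = dockedD[OF docked]
  note PD = plane_arcsD[OF D(1)]
  have P_im: "P g h \<in> arcs_image H (P g) (\<Gamma> g)" if "h \<in> pverts H" for g h
    using that unfolding arcs_image_def by blast
  have \<Gamma>_im: "\<Gamma> g e \<subseteq> arcs_image H (P g) (\<Gamma> g)" if "e \<in> edges H" for g e
    using that unfolding arcs_image_def by blast
  have cb: "arcs_image H (P g) (\<Gamma> g) \<subseteq> cball (p g) r" if "g \<in> pverts G" for g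
    using im[OF that] ball_subset_cball by blast
  have \<delta>c: "\<delta> g g' \<subseteq> cball (p g) r" if g: "g \<in> pverts G" "g' \<in> N g" for g g'
  proof -
    have "x {g, g'} g \<in> cball (p g) r" using xB[OF g(2)] by blast
    then show ?thesis using \<delta>[OF g] ball_subset_cball[of "p g" r] by blast
  qed

  \<comment> \<open>The arcs of the product\<close>
  define S where "S = sierpinski_product G f H"
  \<comment> \<open>An edge of the product is a bare set of two pairs; \<open>inner\<close> and
    \<open>cross\<close> relate it to every way of reading it as an edge within a copy or between
    two copies.\<close>
  define inner where "inner = (\<lambda>(e :: ('a \<times> 'b) set) g h h'. e = {(g, h), (g, h')} \<and> g \<in> pverts G \<and> (h, h') \<in> parcs H)"
  define cross where "cross = (\<lambda>(e :: ('a \<times> 'b) set) g g'. e = {(g, f g'), (g', f g)} \<and> g' \<in> N g)"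
  have S_edges: "(\<exists>g h h'. inner e g h h') \<or> (\<exists>g g'. cross e g g')" if "e \<in> edges S" for e
    using that unfolding edges_def S_def sierpinski_product_def inner_def cross_def N_def by auto
  have cross_sym: "cross e g' g" if "cross e g g'" for e g g'
    using that Nsym unfolding cross_def by (auto simp: insert_commute)
  define Q where "Q = (\<lambda>(g, h). P g h)"
  \<comment> \<open>The unions run over all readings of \<open>e\<close>;
    \<open>\<Lambda>_inner\<close> and \<open>\<Lambda>_cross\<close> show that these give the same
    set and that no edge has readings of both kinds.\<close>
  define \<Lambda> where "\<Lambda> = (\<lambda>e. \<Union> {\<Gamma> g {h, h'} |g h h'. inner e g h h'} \<union>
      \<Union> {B {g, g'} \<union> (\<delta> g g' \<union> \<delta> g' g) |g g'. cross e g g'})"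
  have \<Lambda>E: "(\<exists>g h h'. inner e g h h' \<and> y \<in> \<Gamma> g {h, h'}) \<or> (\<exists>g g'. cross e g g' \<and> (y \<in> B {g, g'} \<or> y \<in> \<delta> g g'))"
    if "y \<in> \<Lambda> e" for y e
    using that cross_sym unfolding \<Lambda>_def by blast
  \<comment> \<open>In the disc of \<open>w\<close> only the copy at \<open>w\<close> is visible.
    The end \<open>x {w, u} w\<close> of \<open>B {w, u}\<close> on the circle is counted to
    \<open>\<delta> w u\<close>, which ends there too.\<close>
  have in_disc: "(\<exists>h h'. inner e w h h' \<and> y \<in> \<Gamma> w {h, h'}) \<or> (\<exists>g'. cross e w g' \<and> y \<in> \<delta> w g')"
    if y: "y \<in> \<Lambda> e" "y \<in> cball (p w) r" and w: "w \<in> pverts G" for y e w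
  proof -
    have eqw: "g = w" if "g \<in> pverts G" "y \<in> cball (p g) r" for g
      using B_D(2)[of g w] that w y(2) by blast
    from \<Lambda>E[OF y(1)] consider g h h' where "inner e g h h'" "y \<in> \<Gamma> g {h, h'}"
      | g g' where "cross e g g'" "y \<in> \<delta> g g'" | g g' where "cross e g g'" "y \<in> B {g, g'}"
      by blast
    then show ?thesis
    proof cases
      case (1 g h h')
      then have g: "g \<in> pverts G" and h: "{h, h'} \<in> edges H" using edgesI unfolding inner_def by fast+
      have "y \<in> cball (p g) r" using \<Gamma>_im[OF h] cb[OF g] 1(2) by blast
      then show ?thesis using eqw[OF g] 1 by blast
    next
      case (2 g g')
      then have g': "g' \<in> N g" unfolding cross_def by blast
      then have g: "g \<in> pverts G" using NV by blast
      have "y \<in> cball (p g) r" using \<delta>c[OF g g'] 2(2) by blast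
      then show ?thesis using eqw[OF g] 2 by blast
    next
      case (3 g g')
      then have g': "g' \<in> N g" unfolding cross_def by blast
      have "w \<in> {g, g'}" using B_D(5)[OF Ne[OF g'] w] 3(2) y(2) by blast
      then obtain u where u: "cross e w u" "{w, u} = {g, g'}"
        using 3(1) cross_sym[OF 3(1)] by (metis insert_commute insertE singletonD)
      then have uN: "u \<in> N w" unfolding cross_def by blast
      have "y \<in> B {w, u} \<inter> cball (p w) r" unfolding u(2) using 3(2) y(2) by blast
      then have "y = x {w, u} w" using xB[OF uN] by blast
      then have "y \<in> \<delta> w u" using arc_between_ends[OF D(2)[OF w uN]] by simp
      then show ?thesis using u(1) by blast
    qed
  qed
  have off_disc: "\<exists>g g'. cross e g g' \<and> y \<in> B {g, g'}"
    if y: "y \<in> \<Lambda> e" "\<not> (\<exists>w\<in>pverts G. y \<in> cball (p w) r)" for y e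
    using \<Lambda>E[OF y(1)]
  proof
    assume "\<exists>g h h'. inner e g h h' \<and> y \<in> \<Gamma> g {h, h'}"
    then obtain g h h' where g: "inner e g h h'" "y \<in> \<Gamma> g {h, h'}" by blast
    then have "g \<in> pverts G" "{h, h'} \<in> edges H" using edgesI unfolding inner_def by fast+
    then show ?thesis using \<Gamma>_im[of "{h, h'}" g] cb[of g] g(2) y(2) by blast
  next
    assume "\<exists>g g'. cross e g g' \<and> (y \<in> B {g, g'} \<or> y \<in> \<delta> g g')"
    then obtain g g' where g: "cross e g g'" "y \<in> B {g, g'} \<or> y \<in> \<delta> g g'" by blast
    then have "g' \<in> N g" "g \<in> pverts G" using NV unfolding cross_def by blast+
    then show ?thesis using \<delta>c[of g g'] g y(2) by blast
  qed
  have \<Lambda>_inner: "\<Lambda> e = \<Gamma> g {h, h'}" if e: "inner e g h h'" for e g h h'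
  proof -
    have "\<Gamma> k {l, l'} = \<Gamma> g {h, h'}" if "inner e k l l'" for k l l'
    proof -
      have "k = g \<and> {l, l'} = {h, h'}"
        using that e unfolding inner_def by (auto simp: doubleton_eq_iff)
      then show ?thesis by simp
    qed
    then have "\<Union> {\<Gamma> k {l, l'} |k l l'. inner e k l l'} = \<Gamma> g {h, h'}" using e by blast
    moreover have "\<not> cross e k k'" for k k'
      using e NV[of k' k] unfolding inner_def cross_def by (auto simp: doubleton_eq_iff)
    ultimately show ?thesis unfolding \<Lambda>_def by simp
  qed
  have \<Lambda>_cross: "\<Lambda> e = B {g, g'} \<union> (\<delta> g g' \<union> \<delta> g' g)" if e: "cross e g g'" for e g g'
  proof -
    have "\<not> inner e k l l'" for k l l'
      using e NV[of g' g] unfolding inner_def cross_def by (auto simp: doubleton_eq_iff)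
    moreover have "B {k, k'} \<union> (\<delta> k k' \<union> \<delta> k' k) = B {g, g'} \<union> (\<delta> g g' \<union> \<delta> g' g)" if "cross e k k'" for k k'
    proof -
      have "k = g \<and> k' = g' \<or> k = g' \<and> k' = g"
        using that e unfolding cross_def by (auto simp: doubleton_eq_iff)
      then show ?thesis by (auto simp: insert_commute)
    qed
    then have "\<Union> {B {k, k'} \<union> (\<delta> k k' \<union> \<delta> k' k) |k k'. cross e k k'} = B {g, g'} \<union> (\<delta> g g' \<union> \<delta> g' g)"
      using e by blast
    ultimately show ?thesis unfolding \<Lambda>_def by simp
  qed
  have Sv: "pverts S = pverts G \<times> pverts H" unfolding S_def sierpinski_product_def by simp

  \<comment> \<open>The arcs of the product form a plane drawing\<close>
  have "plane_arcs S Q \<Lambda>"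
    unfolding plane_arcs_def
  proof (intro conjI allI ballI impI)
    show "inj_on Q (pverts S)"
    proof (rule inj_onI)
      fix a b assume "a \<in> pverts S" "b \<in> pverts S" and eq: "Q a = Q b"
      then obtain g h k l where a: "a = (g, h)" "g \<in> pverts G" "h \<in> pverts H"
        and b: "b = (k, l)" "k \<in> pverts G" "l \<in> pverts H" unfolding Sv by blast
      have eq': "P g h = P k l" using eq a b by (simp add: Q_def)
      have "P g h \<in> cball (p g) r" "P k l \<in> cball (p k) r"
        using P_im[OF a(3), of g] P_im[OF b(3), of k] cb[OF a(2)] cb[OF b(2)] by blast+
      then have "g = k" using B_D(2)[OF a(2) b(2)] eq' by fastforce
      then show "a = b" using PD(1)[OF b(2)] eq' a b by (simp add: inj_on_eq_iff)
    qed
    show "arc_between (\<Lambda> {u, v}) (Q u) (Q v)" if uv: "(u, v) \<in> parcs S" for u v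
    proof -
      from uv consider g h h' where "u = (g, h)" "v = (g, h')" "g \<in> pverts G" "(h, h') \<in> parcs H"
        | g g' where "u = (g, f g')" "v = (g', f g)" "g' \<in> N g"
        unfolding S_def sierpinski_product_def N_def by auto
      then show ?thesis
      proof cases
        case (1 g h h')
        then have "inner {u, v} g h h'" unfolding inner_def by simp
        then show ?thesis using \<Lambda>_inner PD(2)[OF 1(3,4)] 1 by (simp add: Q_def)
      next
        case (2 g g')
        then have c: "cross {u, v} g g'" unfolding cross_def by simp
        have g: "g \<in> pverts G" "g' \<in> pverts G" "g \<noteq> g'" using NV[OF 2(3)] by auto
        have s: "g \<in> N g'" "{g', g} = {g, g'}" using Nsym[OF 2(3)] by auto
        have a1: "arc_between (\<delta> g g') (P g (f g')) (x {g, g'} g)" by (rule D(2)[OF g(1) 2(3)])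
        have a2: "arc_between (\<delta> g' g) (P g' (f g)) (x {g, g'} g')"
          using D(2)[OF g(2) s(1)] unfolding s(2) .
        have a3: "arc_between (B {g, g'}) (x {g, g'} g) (x {g, g'} g')"
          using 2(3) unfolding N_def by (intro B_D(3)) simp
        have "arc_between (B {g, g'} \<union> (\<delta> g g' \<union> \<delta> g' g)) (P g (f g')) (P g' (f g))"
          using arc_between_attach[OF a1 a3 a2 \<delta>c[OF g(1) 2(3)] \<delta>c[OF g(2) s(1)] B_D(2)[OF g]
              xB[OF 2(3)] xB[OF s(1), unfolded s(2)]] .
        then show ?thesis using \<Lambda>_cross[OF c] 2(1,2) by (simp add: Q_def)
      qed
    qed
    fix e assume e: "e \<in> edges S"
    show "\<Lambda> e \<inter> Q ` pverts S \<subseteq> Q ` e"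
    proof
      fix y assume "y \<in> \<Lambda> e \<inter> Q ` pverts S"
      then obtain w k where y: "y \<in> \<Lambda> e" "y = P w k" and w: "w \<in> pverts G" and k: "k \<in> pverts H"
        unfolding Sv Q_def by auto
      have yi: "y \<in> arcs_image H (P w) (\<Gamma> w)" using P_im[OF k] y(2) by simp
      have "y \<in> cball (p w) r" using yi cb[OF w] by blast
      from in_disc[OF y(1) this w] show "y \<in> Q ` e"
      proof (elim disjE exE conjE)
        fix h h' assume h: "inner e w h h'" "y \<in> \<Gamma> w {h, h'}"
        then have "{h, h'} \<in> edges H" using edgesI unfolding inner_def by fast
        from PD(3)[OF w this] have "y \<in> P w ` {h, h'}" using h(2) y(2) k by blast
        then show ?thesis using h(1) unfolding inner_def Q_def by auto
      next
        fix g' assume g': "cross e w g'" "y \<in> \<delta> w g'"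
        then have "g' \<in> N w" unfolding cross_def by blast
        from D(3)[OF w this] have "y = P w (f g')" using g'(2) yi by blast
        then show ?thesis using g'(1) unfolding cross_def Q_def by auto
      qed
    qed
    fix e' assume e': "e' \<in> edges S" and ne: "e \<noteq> e'"
    show "\<Lambda> e \<inter> \<Lambda> e' \<subseteq> Q ` (e \<inter> e')"
    proof
      fix y assume "y \<in> \<Lambda> e \<inter> \<Lambda> e'"
      then have y: "y \<in> \<Lambda> e" "y \<in> \<Lambda> e'" by auto
      \<comment> \<open>\<open>\<delta> w g'\<close> meets the copy of \<open>H\<close> only in
        \<open>P w (f g')\<close>. If this point is on the edge \<open>{h, h'}\<close>, it is one of
        its ends, hence a common vertex of the two edges of the product.\<close>
      have inner_cross: "y \<in> Q ` (d \<inter> d')"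
        if w: "w \<in> pverts G" and d: "inner d w h h'" "y \<in> \<Gamma> w {h, h'}" and d': "cross d' w g'" "y \<in> \<delta> w g'"
        for d d' w h h' g'
      proof -
        have hh: "{h, h'} \<in> edges H" using d(1) edgesI unfolding inner_def by fast
        have g': "g' \<in> N w" using d'(1) unfolding cross_def by blast
        have fg: "f g' \<in> pverts H" using f NV[OF g'] by blast
        have "y = P w (f g')" using D(3)[OF w g'] d'(2) \<Gamma>_im[OF hh] d(2) by blast
        then have "P w (f g') \<in> P w ` {h, h'}" using PD(3)[OF w hh] d(2) fg by blast
        then have "f g' \<in> {h, h'}"
          using inj_on_image_mem_iff[OF PD(1)[OF w] fg H.edge_subset[OF hh]] by blast
        then have "(w, f g') \<in> d \<inter> d'" using d(1) d'(1) unfolding inner_def cross_def by auto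
        moreover have "y = Q (w, f g')" using \<open>y = P w (f g')\<close> by (simp add: Q_def)
        ultimately show ?thesis by blast
      qed
      show "y \<in> Q ` (e \<inter> e')"
      proof (cases "\<exists>w\<in>pverts G. y \<in> cball (p w) r")
        case True
        then obtain w where w: "w \<in> pverts G" and yw: "y \<in> cball (p w) r" by blast
        from in_disc[OF y(1) yw w] in_disc[OF y(2) yw w]
        consider h h' k k' where "inner e w h h'" "y \<in> \<Gamma> w {h, h'}" "inner e' w k k'" "y \<in> \<Gamma> w {k, k'}"
          | h h' g' where "inner e w h h'" "y \<in> \<Gamma> w {h, h'}" "cross e' w g'" "y \<in> \<delta> w g'"
          | h h' g' where "inner e' w h h'" "y \<in> \<Gamma> w {h, h'}" "cross e w g'" "y \<in> \<delta> w g'"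
          | u v where "cross e w u" "y \<in> \<delta> w u" "cross e' w v" "y \<in> \<delta> w v"
          by blast
        then show ?thesis
        proof cases
          case (1 h h' k k')
          have hk: "{h, h'} \<in> edges H" "{k, k'} \<in> edges H"
            using 1(1,3) edgesI unfolding inner_def by fast+
          have ee: "e = Pair w ` {h, h'}" "e' = Pair w ` {k, k'}"
            using 1(1,3) unfolding inner_def by auto
          then have "{h, h'} \<noteq> {k, k'}" using ne by metis
          then have "y \<in> P w ` ({h, h'} \<inter> {k, k'})" using PD(4)[OF w hk] 1(2,4) by blast
          then obtain l where l: "l \<in> {h, h'}" "l \<in> {k, k'}" "y = P w l" by blast
          then have "(w, l) \<in> e \<inter> e'" unfolding ee by blast
          moreover have "y = Q (w, l)" using l(3) by (simp add: Q_def)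
          ultimately show ?thesis by blast
        next
          case 2
          then show ?thesis by (rule inner_cross[OF w])
        next
          case 3
          then show ?thesis using inner_cross[OF w 3] by (simp add: Int_commute)
        next
          \<comment> \<open>Two arcs leaving the same copy can meet only if
            \<open>f u = f v\<close>, and then both edges of the product do share the vertex
            \<open>(w, f u)\<close>.\<close>
          case (4 u v)
          have uv: "u \<in> N w" "v \<in> N w" using 4(1,3) unfolding cross_def by blast+
          have "u \<noteq> v" using 4(1,3) ne unfolding cross_def by metis
          then have eq: "y = P w (f u)" "y = P w (f v)" using D(4)[OF w uv] 4(2,4) by blast+
          moreover have "f u \<in> pverts H" "f v \<in> pverts H" using f NV[OF uv(1)] NV[OF uv(2)] by blast+
          ultimately have "f u = f v" using inj_onD[OF PD(1)[OF w]] by metis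
          then have "(w, f u) \<in> e \<inter> e'" using 4(1,3) unfolding cross_def by auto
          moreover have "y = Q (w, f u)" using eq(1) by (simp add: Q_def)
          ultimately show ?thesis by blast
        qed
      next
        case False
        \<comment> \<open>Off the discs only the disjoint pieces \<open>B\<close> remain, and each
          edge of \<open>G\<close> carries exactly one edge between copies.\<close>
        obtain g g' where g: "cross e g g'" "y \<in> B {g, g'}" using off_disc[OF y(1) False] by blast
        obtain k k' where k: "cross e' k k'" "y \<in> B {k, k'}" using off_disc[OF y(2) False] by blast
        have "{g, g'} \<in> edges G" "{k, k'} \<in> edges G" using g(1) k(1) Ne unfolding cross_def by blast+
        then have "{g, g'} = {k, k'}" using B_D(7) g(2) k(2) by blast
        then have "g = k \<and> g' = k' \<or> g = k' \<and> g' = k" by (simp add: doubleton_eq_iff)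
        then have "cross e' g g'" using k(1) cross_sym by blast
        then have "e = e'" using g(1) unfolding cross_def by simp
        then show ?thesis using ne by simp
      qed
    qed
  qed
  moreover have "parcs S \<subseteq> pverts S \<times> pverts S"
    using f G.in_arcsD1 G.in_arcsD2 H.in_arcsD1 H.in_arcsD2
    unfolding S_def sierpinski_product_def by auto
  ultimately show ?thesis using plane_arcs_imp_planar unfolding S_def by blast
qed

end
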